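(* Let $d\geq 2$ be a fixed integer, let $\beta>0$ and $0\leq\alpha\leq\beta$. Define $$S(d,dn;\beta)=\sum_{\substack{\lambda\vdash dn\\ \ell(\lambda)\leq d}}(\dim\lambda)^\beta.$$ Then, as $n\to\infty$, $$S(d,dn;\beta)\sim\sum_{\substack{\mu\vdash dn\\ \mu\subseteq R(d,2n)}}(\dim\mu)^\alpha(\dim\mu^* )^{\beta-\alpha}.$$
   Context: For a partition $\lambda$, $\dim\lambda$ is the number of standard Young tableaux of shape $\lambda$, $\ell(\lambda)$ is its number of nonzero parts, and $\lambda\vdash m$ means $\lambda$ is a partition of $m$. $R(d,q)$ is the $d\times q$ rectangular diagram $(q,\dots,q)$ ($d$ parts). For $\mu=(\mu_1,\dots,\mu_d)\subseteq R(d,2n)$ (padded with zeros to $d$ parts), $\mu^*=(2n-\mu_d,\dots,2n-\mu_1)$ is its complement relative to $R(d,2n)$. The notation $a_n\sim b_n$ means $a_n/b_n\to1$. *)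

theory Defs
  imports "HOL-Analysis.Analysis" "HOL-Library.Landau_Symbols"
begin

text \<open>
  A partition is its sequence of parts, extended by zeros: a weakly decreasing function on the
  natural numbers with finite support. Indices start at 0, so \<open>\<nu> 0\<close> is the largest part.
\<close>

definition is_partition :: "(nat \<Rightarrow> nat) \<Rightarrow> bool" where
  "is_partition \<nu> \<longleftrightarrow> antimono \<nu> \<and> finite {i. \<nu> i \<noteq> 0}"

definition psize :: "(nat \<Rightarrow> nat) \<Rightarrow> nat" where
  "psize \<nu> = (\<Sum>i | \<nu> i \<noteq> 0. \<nu> i)"

definition partition_of :: "(nat \<Rightarrow> nat) \<Rightarrow> nat \<Rightarrow> bool"  (infix "\<turnstile>" 50) where
  "\<nu> \<turnstile> m \<longleftrightarrow> is_partition \<nu> \<and> psize \<nu> = m"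

definition plength :: "(nat \<Rightarrow> nat) \<Rightarrow> nat" where
  "plength \<nu> = card {i. \<nu> i \<noteq> 0}"

definition diagram :: "(nat \<Rightarrow> nat) \<Rightarrow> (nat \<times> nat) set" where
  "diagram \<nu> = {(i, j). j < \<nu> i}"

text \<open>
  Fillings are taken to be \<open>extensional\<close> (fixed outside the diagram), so that each tableau is
  counted exactly once.
\<close>

definition standard_tableaux :: "(nat \<Rightarrow> nat) \<Rightarrow> (nat \<times> nat \<Rightarrow> nat) set" where
  "standard_tableaux \<nu> =
     {T \<in> extensional (diagram \<nu>).
        bij_betw T (diagram \<nu>) {1..psize \<nu>} \<and>
        (\<forall>i j. (i, Suc j) \<in> diagram \<nu> \<longrightarrow> T (i, j) < T (i, Suc j)) \<and>
        (\<forall>i j. (Suc i, j) \<in> diagram \<nu> \<longrightarrow> T (i, j) < T (Suc i, j))}"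

definition pdim :: "(nat \<Rightarrow> nat) \<Rightarrow> nat" where
  "pdim \<nu> = card (standard_tableaux \<nu>)"

definition rectangle :: "nat \<Rightarrow> nat \<Rightarrow> nat \<Rightarrow> nat" where
  "rectangle d q = (\<lambda>i. if i < d then q else 0)"

text \<open>
  Complement of \<open>\<mu>\<close> relative to \<open>rectangle d q\<close>; the truncated subtraction is only meaningful
  when \<open>\<mu>\<close> is contained in that rectangle.
\<close>

definition complement_in :: "nat \<Rightarrow> nat \<Rightarrow> (nat \<Rightarrow> nat) \<Rightarrow> nat \<Rightarrow> nat" where
  "complement_in d q \<mu> = (\<lambda>i. if i < d then q - \<mu> (d - 1 - i) else 0)"

definition S :: "nat \<Rightarrow> nat \<Rightarrow> real \<Rightarrow> real" where
  "S d m \<beta> = (\<Sum>\<nu> | \<nu> \<turnstile> m \<and> plength \<nu> \<le> d. real (pdim \<nu>) powr \<beta>)"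

end

theory Submission
  imports Defs "HOL-Real_Asymp.Real_Asymp"
begin

text \<open>
  By Frobenius' formula, \<open>dim \<lambda> = N! \<Prod>\<^bsub>i<j\<^esub> (l\<^sub>i - l\<^sub>j) / \<Prod>\<^sub>i l\<^sub>i!\<close> with
  \<open>l\<^sub>i = \<lambda>\<^sub>i + d - i\<close>. Passing from \<open>\<mu>\<close> to \<open>\<mu>\<^sup>*\<close> replaces each \<open>l\<^sub>i\<close> by
  \<open>2n + d - 1 - l\<^sub>i\<close>, in reverse order, and keeps the product of differences, so
  \<open>dim \<mu>\<^sup>* / dim \<mu>\<close> is a quotient of factorials. If all rows of \<open>\<mu>\<close> are within
  \<open>n\<^bsup>3/5\<^esup>\<close> of \<open>n\<close>, the expansion of \<open>ln (n + k)!\<close> to second order in \<open>k\<close> shows that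
  this quotient tends to 1 uniformly: the terms of order at most two cancel because the rows sum
  to \<open>dn\<close>. Every other \<open>\<lambda>\<close> has a row shorter than \<open>n\<close> by at least \<open>n\<^bsup>3/5\<^esup> / d\<close>, which
  makes \<open>dim \<lambda>\<close> smaller than the dimension of the \<open>d \<times> n\<close> rectangle by a factor
  \<open>exp (- c n\<^bsup>1/5\<^esup>)\<close>, up to a power of \<open>n\<close>. As there are only polynomially many \<open>\<lambda>\<close>, these
  contribute negligibly to \<open>S\<close>, and \<open>x\<^bsup>\<alpha>\<^esup> y\<^bsup>\<beta>-\<alpha>\<^esup> \<le> x\<^bsup>\<beta>\<^esup> + y\<^bsup>\<beta>\<^esup>\<close> carries this
  over to the other sum.
\<close>

subsection \<open>Removing the largest entry of a standard tableau\<close>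

lemma finite_diagram: "is_partition \<nu> \<Longrightarrow> finite (diagram \<nu>)"
  and card_diagram: "is_partition \<nu> \<Longrightarrow> card (diagram \<nu>) = psize \<nu>"
proof -
  assume "is_partition \<nu>"
  then have fin: "finite {i. \<nu> i \<noteq> 0}" by (simp add: is_partition_def)
  have eq: "diagram \<nu> = (SIGMA i:{i. \<nu> i \<noteq> 0}. {..<\<nu> i})"
    by (auto simp: diagram_def)
  show "finite (diagram \<nu>)" unfolding eq using fin by auto
  show "card (diagram \<nu>) = psize \<nu>" unfolding eq psize_def using fin by simp
qed

lemma finite_standard_tableaux: "is_partition \<nu> \<Longrightarrow> finite (standard_tableaux \<nu>)"
  by (rule finite_subset[of _ "PiE (diagram \<nu>) (\<lambda>_. {1..psize \<nu>})"])
     (auto simp: standard_tableaux_def PiE_def bij_betw_def,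
      metis PiE_def finite_PiE finite_atLeastAtMost finite_diagram)

text \<open>A corner is recorded by its row alone; the removable box of row \<open>i\<close> is
  \<open>(i, \<nu> i - 1)\<close>.\<close>

definition corners :: "(nat \<Rightarrow> nat) \<Rightarrow> nat set" where
  "corners \<nu> = {i. \<nu> (Suc i) < \<nu> i}"

definition remove_box :: "(nat \<Rightarrow> nat) \<Rightarrow> nat \<Rightarrow> nat \<Rightarrow> nat" where
  "remove_box \<nu> i = \<nu>(i := \<nu> i - 1)"

lemma finite_corners: "is_partition \<nu> \<Longrightarrow> finite (corners \<nu>)"
  by (rule finite_subset[of _ "{i. \<nu> i \<noteq> 0}"]) (auto simp: corners_def is_partition_def)

lemma diagram_remove_box:
  assumes "i \<in> corners \<nu>"
  shows "diagram (remove_box \<nu> i) = diagram \<nu> - {(i, \<nu> i - 1)}"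
  using assms by (auto simp: diagram_def remove_box_def corners_def split: if_splits)

lemma antimono_remove_box:
  assumes "antimono \<nu>" and "i \<in> corners \<nu>"
  shows "antimono (remove_box \<nu> i)"
  unfolding antimono_iff_le_Suc
proof
  fix k
  have "\<nu> (Suc k) \<le> \<nu> k" using assms(1) by (auto simp: antimono_iff_le_Suc)
  then show "remove_box \<nu> i (Suc k) \<le> remove_box \<nu> i k"
    using assms(2) by (auto simp: remove_box_def corners_def)
qed

lemma is_partition_remove_box:
  assumes "is_partition \<nu>" and "i \<in> corners \<nu>"
  shows "is_partition (remove_box \<nu> i)"
proof -
  have "{k. remove_box \<nu> i k \<noteq> 0} \<subseteq> {k. \<nu> k \<noteq> 0}" by (auto simp: remove_box_def)
  then show ?thesis
    using assms antimono_remove_box by (auto simp: is_partition_def intro: finite_subset)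
qed

lemma psize_remove_box:
  assumes "is_partition \<nu>" and "i \<in> corners \<nu>"
  shows "psize \<nu> = Suc (psize (remove_box \<nu> i))"
proof -
  have c: "(i, \<nu> i - 1) \<in> diagram \<nu>" using assms(2) by (auto simp: diagram_def corners_def)
  have "psize (remove_box \<nu> i) = card (diagram \<nu> - {(i, \<nu> i - 1)})"
    using card_diagram[OF is_partition_remove_box[OF assms]] diagram_remove_box[OF assms(2)] by simp
  then show ?thesis
    using card_Suc_Diff1[OF finite_diagram[OF assms(1)] c] card_diagram[OF assms(1)] by simp
qed

lemma diagram_left: "(i, Suc j) \<in> diagram \<nu> \<Longrightarrow> (i, j) \<in> diagram \<nu>"
  by (simp add: diagram_def)

lemma diagram_up: "is_partition \<nu> \<Longrightarrow> (Suc i, j) \<in> diagram \<nu> \<Longrightarrow> (i, j) \<in> diagram \<nu>"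
  by (auto simp: diagram_def is_partition_def antimono_iff_le_Suc intro: less_le_trans)

text \<open>Deleting the corner that holds the largest entry is undone by writing that entry back.
  Restricting the filling to the smaller diagram keeps it extensional, so this is a bijection on the
  functions themselves.\<close>

lemma card_tableaux_max_in_corner:
  assumes \<nu>: "is_partition \<nu>" and i: "i \<in> corners \<nu>"
  shows "card {T \<in> standard_tableaux \<nu>. T (i, \<nu> i - 1) = psize \<nu>} = pdim (remove_box \<nu> i)"
proof -
  define c where "c = (i, \<nu> i - 1)"
  define \<nu>' where "\<nu>' = remove_box \<nu> i"
  define N where "N = psize \<nu>"
  have \<nu>': "is_partition \<nu>'" unfolding \<nu>'_def by (rule is_partition_remove_box[OF \<nu> i])
  have N: "psize \<nu>' = N - 1" "N > 0" 
    using psize_remove_box[OF \<nu> i] by (auto simp: \<nu>'_def N_def)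
  have D': "diagram \<nu>' = diagram \<nu> - {c}"
    unfolding \<nu>'_def c_def by (rule diagram_remove_box[OF i])
  have c: "c \<in> diagram \<nu>" using i by (auto simp: c_def diagram_def corners_def)
  have ND: "{1..N - 1} = {1..N} - {N}" using N by auto
  \<comment> \<open>With no right or lower neighbour, \<open>c\<close> can only be the larger side
    of a tableau inequality, where the value \<open>N\<close> is harmless.\<close>
  have c_right: "(fst c, Suc (snd c)) \<notin> diagram \<nu>" and c_below: "(Suc (fst c), snd c) \<notin> diagram \<nu>"
    using i by (auto simp: c_def diagram_def corners_def)
  have "bij_betw (\<lambda>T. restrict T (diagram \<nu>')) {T \<in> standard_tableaux \<nu>. T c = N}
          (standard_tableaux \<nu>')"
  proof (rule bij_betw_byWitness[where f' = "\<lambda>U. U(c := N)"])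
    show "\<forall>T\<in>{T \<in> standard_tableaux \<nu>. T c = N}. (restrict T (diagram \<nu>'))(c := N) = T"
      using c by (auto simp: standard_tableaux_def D' extensional_def restrict_def fun_eq_iff)
    show "\<forall>U\<in>standard_tableaux \<nu>'. restrict (U(c := N)) (diagram \<nu>') = U"
      by (auto simp: standard_tableaux_def D' extensional_def restrict_def fun_eq_iff)
    show "(\<lambda>T. restrict T (diagram \<nu>')) ` {T \<in> standard_tableaux \<nu>. T c = N} \<subseteq> standard_tableaux \<nu>'"
    proof safe
      fix T assume T: "T \<in> standard_tableaux \<nu>" "N = T c"
      have "bij_betw T (diagram \<nu>) {1..N}" using T by (simp add: standard_tableaux_def N_def)
      then have "bij_betw T (diagram \<nu> - {c}) ({1..N} - {N})"
        using c T(2) by (auto simp: bij_betw_def inj_on_def)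
      then have b: "bij_betw (restrict T (diagram \<nu>')) (diagram \<nu>') {1..psize \<nu>'}"
        unfolding N(1) ND D' by (subst bij_betw_restrict_eq)
      have 1: "T (a, b) < T (a, Suc b)" if "(a, Suc b) \<in> diagram \<nu>" for a b
        using that T by (simp add: standard_tableaux_def)
      have 2: "T (a, b) < T (Suc a, b)" if "(Suc a, b) \<in> diagram \<nu>" for a b
        using that T by (simp add: standard_tableaux_def)
      show "restrict T (diagram \<nu>') \<in> standard_tableaux \<nu>'"
        unfolding standard_tableaux_def
      proof (intro CollectI conjI allI impI b)
        fix a b
        show "restrict T (diagram \<nu>') (a, b) < restrict T (diagram \<nu>') (a, Suc b)"
          if "(a, Suc b) \<in> diagram \<nu>'"
          using that diagram_left[OF that] 1[of a b] by (simp add: D')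
        show "restrict T (diagram \<nu>') (a, b) < restrict T (diagram \<nu>') (Suc a, b)"
          if "(Suc a, b) \<in> diagram \<nu>'"
          using that diagram_up[OF \<nu>' that] 2[of a b] by (simp add: D')
      qed simp
    qed
    show "(\<lambda>U. U(c := N)) ` standard_tableaux \<nu>' \<subseteq> {T \<in> standard_tableaux \<nu>. T c = N}"
    proof safe
      fix U assume U: "U \<in> standard_tableaux \<nu>'"
      have bU: "bij_betw U (diagram \<nu>') {1..N - 1}" using U by (simp add: standard_tableaux_def N)
      then have "bij_betw (U(c := N)) (diagram \<nu>') {1..N - 1}"
        by (rule bij_betw_cong[THEN iffD1, rotated]) (auto simp: D')
      then have "bij_betw (U(c := N)) (insert c (diagram \<nu>')) (insert N {1..N - 1})"
        using notIn_Un_bij_betw[of c "diagram \<nu>'" "U(c := N)" "{1..N-1}"] N by (simp add: D')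
      moreover have "insert c (diagram \<nu>') = diagram \<nu>" using c D' by auto
      moreover have "insert N {1..N - 1} = {1..N}" using N by auto
      ultimately have b: "bij_betw (U(c := N)) (diagram \<nu>) {1..psize \<nu>}" by (simp add: N_def)
      have small: "U p < N" if "p \<in> diagram \<nu>'" for p
        using bij_betwE[OF bU] that N by force
      have 1: "(U(c := N)) (a, b) < (U(c := N)) (a, Suc b)" if ab: "(a, Suc b) \<in> diagram \<nu>" for a b
      proof (cases "(a, Suc b) = c")
        case True
        then show ?thesis using diagram_left[OF ab] by (auto intro!: small simp: D')
      next
        case False
        with ab have "(a, Suc b) \<in> diagram \<nu>'" by (simp add: D')
        moreover have "(a, b) \<noteq> c" using ab c_right by auto
        ultimately show ?thesis using U False by (auto simp: standard_tableaux_def)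
      qed
      have 2: "(U(c := N)) (a, b) < (U(c := N)) (Suc a, b)" if ab: "(Suc a, b) \<in> diagram \<nu>" for a b
      proof (cases "(Suc a, b) = c")
        case True
        then show ?thesis using diagram_up[OF \<nu> ab] by (auto intro!: small simp: D')
      next
        case False
        with ab have "(Suc a, b) \<in> diagram \<nu>'" by (simp add: D')
        moreover have "(a, b) \<noteq> c" using ab c_below by auto
        ultimately show ?thesis using U False by (auto simp: standard_tableaux_def)
      qed
      show "U(c := N) \<in> standard_tableaux \<nu>"
        unfolding standard_tableaux_def
      proof (intro CollectI conjI allI impI b 1 2)
        show "U(c := N) \<in> extensional (diagram \<nu>)"
          using U c by (auto simp: standard_tableaux_def extensional_def D')
      qed
    qed auto
  qed
  then show ?thesis by (simp add: bij_betw_same_card pdim_def c_def N_def \<nu>'_def)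
qed

text \<open>A box to the right of or below the largest entry would need a still larger one.\<close>

lemma max_entry_in_corner:
  assumes \<nu>: "is_partition \<nu>" and pos: "psize \<nu> > 0" and T: "T \<in> standard_tableaux \<nu>"
  obtains i where "i \<in> corners \<nu>" and "T (i, \<nu> i - 1) = psize \<nu>"
proof -
  have b: "bij_betw T (diagram \<nu>) {1..psize \<nu>}" using T by (simp add: standard_tableaux_def)
  then obtain i j where ij: "(i, j) \<in> diagram \<nu>" "T (i, j) = psize \<nu>"
    using pos unfolding bij_betw_def by (metis One_nat_def Suc_leI atLeastAtMost_iff imageE le_refl surj_pair)
  have le: "T p \<le> psize \<nu>" if "p \<in> diagram \<nu>" for p using bij_betwE[OF b] that by auto
  have "(i, Suc j) \<notin> diagram \<nu>" "(Suc i, j) \<notin> diagram \<nu>"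
    using T ij le by (auto simp: standard_tableaux_def) (metis leD)+
  then have "i \<in> corners \<nu>" "j = \<nu> i - 1" using ij(1) by (auto simp: diagram_def corners_def)
  then show thesis using that ij(2) by auto
qed

text \<open>Tableaux are sorted by the corner holding their largest entry; injectivity of a tableau
  makes the classes disjoint.\<close>

lemma pdim_rec:
  assumes \<nu>: "is_partition \<nu>" and pos: "psize \<nu> > 0"
  shows "pdim \<nu> = (\<Sum>i\<in>corners \<nu>. pdim (remove_box \<nu> i))"
proof -
  let ?X = "\<lambda>i. {T \<in> standard_tableaux \<nu>. T (i, \<nu> i - 1) = psize \<nu>}"
  have "standard_tableaux \<nu> = (\<Union>i\<in>corners \<nu>. ?X i)"
    using max_entry_in_corner[OF assms] by auto
  then have "pdim \<nu> = card (\<Union>i\<in>corners \<nu>. ?X i)" by (simp add: pdim_def)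
  also have "\<dots> = (\<Sum>i\<in>corners \<nu>. card (?X i))"
  proof (rule card_UN_disjoint)
    show "\<forall>i\<in>corners \<nu>. \<forall>j\<in>corners \<nu>. i \<noteq> j \<longrightarrow> ?X i \<inter> ?X j = {}"
    proof (intro ballI impI equals0I)
      fix i j T assume ij: "i \<in> corners \<nu>" "j \<in> corners \<nu>" "i \<noteq> j" and T: "T \<in> ?X i \<inter> ?X j"
      have "(i, \<nu> i - 1) \<in> diagram \<nu>" "(j, \<nu> j - 1) \<in> diagram \<nu>"
        using ij by (auto simp: diagram_def corners_def)
      moreover have "inj_on T (diagram \<nu>)" using T by (auto simp: standard_tableaux_def bij_betw_def)
      ultimately show False using T ij(3) inj_onD[of T "diagram \<nu>" "(i, \<nu> i - 1)" "(j, \<nu> j - 1)"] by auto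
    qed
  qed (use \<nu> in \<open>auto simp: finite_corners finite_standard_tableaux\<close>)
  also have "\<dots> = (\<Sum>i\<in>corners \<nu>. pdim (remove_box \<nu> i))"
    using card_tableaux_max_in_corner[OF \<nu>] by simp
  finally show ?thesis .
qed

lemma pdim_empty: "pdim (\<lambda>_. 0) = 1"
proof -
  have "standard_tableaux (\<lambda>_. 0) = {\<lambda>_. undefined}"
    by (auto simp: standard_tableaux_def diagram_def psize_def bij_betw_def)
  then show ?thesis by (simp add: pdim_def)
qed

subsection \<open>The dimension formula\<close>

text \<open>
  The factor by which a Vandermonde product in the variables \<open>x\<close> changes when \<open>x i\<close> decreases by 1.
\<close>

definition decrement_weight :: "nat set \<Rightarrow> (nat \<Rightarrow> real) \<Rightarrow> nat \<Rightarrow> real" where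
  "decrement_weight A x i = (\<Prod>j\<in>A - {i}. 1 - 1 / (x i - x j))"

section \<open>Partial fraction identities for the decrement weights\<close>

lemma decrement_weight_insert:
  assumes "finite A" "k \<notin> A" "i \<in> A"
  shows "decrement_weight (insert k A) x i = (1 - 1 / (x i - x k)) * decrement_weight A x i"
proof -
  have "insert k A - {i} = insert k (A - {i})" using assms by auto
  then show ?thesis using assms by (simp add: decrement_weight_def)
qed

lemma decrement_weight_insert_self:
  assumes "k \<notin> A"
  shows "decrement_weight (insert k A) x k = (\<Prod>j\<in>A. 1 - 1 / (x k - x j))"
  using assms by (simp add: decrement_weight_def)

text \<open>As a rational function of \<open>y\<close>, the product tends to 1 at infinity and has
  simple poles at the \<open>x i\<close> with residues \<open>- decrement_weight A x i\<close>. The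
  induction avoids limits and expands one new factor at a time.\<close>

lemma prod_partial_fractions:
  assumes "finite A" "inj_on x A" "y \<notin> x ` A"
  shows "(\<Prod>j\<in>A. 1 - 1 / (y - x j)) = 1 - (\<Sum>i\<in>A. decrement_weight A x i / (y - x i))"
  using assms
proof (induction A arbitrary: y rule: finite_induct)
  case (insert k A)
  let ?w = "decrement_weight A x"
  have yk: "y - x k \<noteq> 0" and ky: "x k \<notin> x ` A" using insert.prems insert.hyps by auto
  have "?w i / (y - x i) * (1 / (y - x k)) =
      1 / (x i - x k) * ?w i / (y - x i) + ?w i / (x k - x i) / (y - x k)" if "i \<in> A" for i
  proof -
    have "x i \<noteq> x k" using ky that by (metis imageI)
    then have nz: "y - x i \<noteq> 0" "x i - x k \<noteq> 0" "x k - x i \<noteq> 0"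
      using insert.prems that by auto
    \<comment> \<open>This is \<open>1 / (a * (a + e)) = (1 / a - 1 / (a + e)) / e\<close>, used
      with \<open>a = y - x i\<close> and \<open>a + e = y - x k\<close>.\<close>
    have split: "w / a * (1 / (a + e)) = 1 / e * w / a + w / (- e) / (a + e)"
      if "a \<noteq> 0" "e \<noteq> 0" "a + e \<noteq> 0" for a e w :: real
      using that by (simp add: divide_simps) (simp add: algebra_simps)
    show ?thesis using split[of "y - x i" "x i - x k" "?w i"] yk nz by simp
  qed
  then have "(\<Sum>i\<in>A. ?w i / (y - x i)) * (1 / (y - x k)) =
      (\<Sum>i\<in>A. 1 / (x i - x k) * ?w i / (y - x i)) + (\<Sum>i\<in>A. ?w i / (x k - x i)) / (y - x k)"
    by (simp add: sum_distrib_right sum_divide_distrib sum.distrib)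
  \<comment> \<open>The numerator over \<open>y - x k\<close> is the induction hypothesis taken at
    the point \<open>x k\<close>, that is, the weight of the new index \<open>k\<close>.\<close>
  then have *: "(1 - (\<Sum>i\<in>A. ?w i / (y - x i))) * (1 - 1 / (y - x k)) =
      1 - (\<Sum>i\<in>A. (1 - 1 / (x i - x k)) * ?w i / (y - x i))
        - (1 - (\<Sum>i\<in>A. ?w i / (x k - x i))) / (y - x k)"
    by (simp add: algebra_simps diff_divide_distrib sum_subtractf)
  have "(\<Prod>j\<in>insert k A. 1 - 1 / (y - x j)) =
      (1 - (\<Sum>i\<in>A. ?w i / (y - x i))) * (1 - 1 / (y - x k))"
    using insert by simp
  also have "\<dots> = 1 - (\<Sum>i\<in>insert k A. decrement_weight (insert k A) x i / (y - x i))"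
    unfolding * using insert ky
    by (simp add: decrement_weight_insert decrement_weight_insert_self cong: sum.cong)
  finally show ?case .
qed simp

text \<open>Inserting \<open>k\<close> changes the old weights by a total that cancels the sum in
  the partial fraction form of the new weight, so exactly 1 is gained.\<close>

lemma sum_decrement_weight:
  assumes "finite A" "inj_on x A"
  shows "(\<Sum>i\<in>A. decrement_weight A x i) = card A"
  using assms
proof (induction A rule: finite_induct)
  case (insert k A)
  have ky: "x k \<notin> x ` A" and inj: "inj_on x A" using insert by auto
  have "(\<Sum>i\<in>A. (1 - 1 / (x i - x k)) * decrement_weight A x i) =
      (\<Sum>i\<in>A. decrement_weight A x i) + (\<Sum>i\<in>A. decrement_weight A x i / (x k - x i))"
    unfolding sum.distrib[symmetric]
    by (intro sum.cong refl) (simp add: left_diff_distrib minus_divide_right)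
  then show ?case using insert prod_partial_fractions[OF insert.hyps(1) inj ky]
    by (simp add: decrement_weight_insert decrement_weight_insert_self cong: sum.cong)
qed simp

text \<open>This drives the dimension formula: when the \<open>x i\<close> are the beta numbers of a
  partition, the right-hand side is its size.\<close>

lemma sum_mult_decrement_weight:
  assumes "finite A" "inj_on x A"
  shows "(\<Sum>i\<in>A. x i * decrement_weight A x i) = (\<Sum>i\<in>A. x i) - (\<Sum>k<card A. real k)"
  using assms
proof (induction A rule: finite_induct)
  case (insert k A)
  let ?w = "decrement_weight A x"
  have ky: "x k \<notin> x ` A" and inj: "inj_on x A" using insert by auto
  \<comment> \<open>Here \<open>x i / (x i - x k)\<close> is written as
    \<open>1 + x k / (x i - x k)\<close>, which reduces everything to sums already known.\<close>
  have "x i * ((1 - 1 / (x i - x k)) * ?w i) = x i * ?w i + x k * (?w i / (x k - x i)) - ?w i"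
    if "i \<in> A" for i
  proof -
    have "x i \<noteq> x k" using ky that by (metis imageI)
    then have "x i - x k \<noteq> 0" "x k - x i \<noteq> 0" by auto
    then show ?thesis by (simp add: field_simps)
  qed
  then have "(\<Sum>i\<in>A. x i * ((1 - 1 / (x i - x k)) * ?w i)) =
      (\<Sum>i\<in>A. x i * ?w i) + x k * (\<Sum>i\<in>A. ?w i / (x k - x i)) - (\<Sum>i\<in>A. ?w i)"
    by (simp add: sum.distrib sum_subtractf sum_distrib_left)
  moreover have "(\<Sum>i\<in>insert k A. x i * decrement_weight (insert k A) x i) =
      x k * (1 - (\<Sum>i\<in>A. ?w i / (x k - x i))) + (\<Sum>i\<in>A. x i * ((1 - 1 / (x i - x k)) * ?w i))"
    using insert prod_partial_fractions[OF insert.hyps(1) inj ky]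
    by (simp add: decrement_weight_insert decrement_weight_insert_self cong: sum.cong)
  ultimately show ?case
    using insert.hyps insert.IH[OF inj] sum_decrement_weight[OF insert.hyps(1) inj]
    by (simp add: algebra_simps)
qed simp

text \<open>
  The absolute values allow \<open>vdm_insert\<close> to add an index at any position; they are redundant for the
  strictly decreasing sequences of interest.
\<close>

definition vdm :: "nat set \<Rightarrow> (nat \<Rightarrow> real) \<Rightarrow> real" where
  "vdm J l = (\<Prod>(i, j) | i \<in> J \<and> j \<in> J \<and> i < j. \<bar>l i - l j\<bar>)"

lemma vdm_cong: "(\<And>i. i \<in> J \<Longrightarrow> l i = l' i) \<Longrightarrow> vdm J l = vdm J l'"
  unfolding vdm_def by (intro prod.cong) auto

lemma vdm_insert:
  assumes "finite J" "k \<notin> J"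
  shows "vdm (insert k J) l = vdm J l * (\<Prod>j\<in>J. \<bar>l k - l j\<bar>)"
proof -
  let ?pairs = "\<lambda>J. {(i, j). i \<in> J \<and> j \<in> J \<and> i < j}"
  \<comment> \<open>Sorting \<open>j\<close> and \<open>k\<close> by \<open>min\<close> and
    \<open>max\<close> lists the new pairs wherever \<open>k\<close> lies relative to
    \<open>J\<close>.\<close>
  let ?g = "\<lambda>j. (min j k, max j k)"
  have "?pairs (insert k J) = ?pairs J \<union> ?g ` J"
  proof (intro equalityI subrelI)
    fix i j assume ij: "(i, j) \<in> ?pairs (insert k J)"
    then consider "i \<in> J" "j \<in> J" | "j \<in> J" "(i, j) = ?g j" | "i \<in> J" "(i, j) = ?g i"
      by (auto simp: min_def max_def)
    then show "(i, j) \<in> ?pairs J \<union> ?g ` J"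
      using ij by cases blast+
  next
    fix i j assume "(i, j) \<in> ?pairs J \<union> ?g ` J"
    then consider "(i, j) \<in> ?pairs J" | m where "m \<in> J" "(i, j) = ?g m" by blast
    then show "(i, j) \<in> ?pairs (insert k J)"
    proof cases
      case (2 m)
      then have "m \<noteq> k" using assms(2) by auto
      with 2 show ?thesis by (cases "m < k") auto
    qed auto
  qed
  moreover have "?pairs J \<inter> ?g ` J = {}" using assms(2) by (auto simp: min_def max_def split: if_splits)
  moreover have "finite (?pairs J)" by (rule finite_subset[of _ "J \<times> J"]) (use assms in auto)
  ultimately have "vdm (insert k J) l = vdm J l * (\<Prod>(i, j)\<in>?g ` J. \<bar>l i - l j\<bar>)"
    unfolding vdm_def using assms(1) by (simp add: prod.union_disjoint)
  also have "inj_on ?g J" using assms(2) by (auto simp: inj_on_def min_def max_def split: if_splits)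
  then have "(\<Prod>(i, j)\<in>?g ` J. \<bar>l i - l j\<bar>) = (\<Prod>j\<in>J. \<bar>l k - l j\<bar>)"
    by (subst prod.reindex) (auto simp: min_def max_def abs_minus_commute intro!: prod.cong)
  finally show ?thesis .
qed

lemma vdm_empty [simp]: "vdm {} l = 1"
  by (simp add: vdm_def)

lemma vdm_pos:
  assumes "finite J" "inj_on l J"
  shows "vdm J l > 0"
  unfolding vdm_def using assms(2) by (intro prod_pos) (auto dest: inj_onD)

lemma vdm_decrement:
  fixes L :: "nat \<Rightarrow> nat"
  assumes "finite J" "k \<in> J" "inj_on L J" "L k > 0"
  shows "vdm J (\<lambda>i. real ((L(k := L k - 1)) i)) =
           vdm J (\<lambda>i. real (L i)) * decrement_weight J (\<lambda>i. real (L i)) k"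
proof -
  define B where "B = J - {k}"
  have B: "J = insert k B" "finite B" "k \<notin> B" using assms by (auto simp: B_def)
  \<comment> \<open>Lowering one of two distinct integers by 1 cannot reverse the sign of their
    difference, so the absolute values are compatible with the factor. Positivity of
    \<open>L k\<close> makes the natural subtraction exact.\<close>
  have step: "\<bar>real (L k - 1) - real (L j)\<bar> = \<bar>real (L k) - real (L j)\<bar> * (1 - 1 / (real (L k) - real (L j)))"
    if "j \<in> B" for j
  proof -
    have "L k \<noteq> L j" using assms that by (auto simp: B_def dest: inj_onD)
    then consider "real (L k) \<ge> real (L j) + 1" | "real (L k) + 1 \<le> real (L j)" by linarith
    then show ?thesis using assms(4) by cases (auto simp: field_simps of_nat_diff abs_if)
  qed
  have "vdm B (\<lambda>i. real ((L(k := L k - 1)) i)) = vdm B (\<lambda>i. real (L i))"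
    using B by (intro vdm_cong) auto
  moreover have "(\<Prod>j\<in>B. \<bar>real ((L(k := L k - 1)) k) - real ((L(k := L k - 1)) j)\<bar>) =
      (\<Prod>j\<in>B. \<bar>real (L k) - real (L j)\<bar> * (1 - 1 / (real (L k) - real (L j))))"
    using B step by (intro prod.cong) auto
  ultimately show ?thesis
    unfolding B(1) vdm_insert[OF B(2,3)] decrement_weight_insert_self[OF B(3)]
    by (simp add: prod.distrib)
qed

section \<open>Partitions with at most \<open>d\<close> rows and their beta numbers\<close>

definition at_most_rows :: "nat \<Rightarrow> (nat \<Rightarrow> nat) \<Rightarrow> bool" where
  "at_most_rows d \<nu> \<longleftrightarrow> antimono \<nu> \<and> (\<forall>i\<ge>d. \<nu> i = 0)"

lemma at_most_rows_support: "at_most_rows d \<nu> \<Longrightarrow> {i. \<nu> i \<noteq> 0} \<subseteq> {..<d}"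
  by (auto simp: at_most_rows_def not_less[symmetric])

lemma at_most_rows_is_partition: "at_most_rows d \<nu> \<Longrightarrow> is_partition \<nu>"
  using at_most_rows_support[of d \<nu>]
  by (auto simp: is_partition_def at_most_rows_def intro: finite_subset)

lemma psize_eq_sum: "at_most_rows d \<nu> \<Longrightarrow> psize \<nu> = (\<Sum>i<d. \<nu> i)"
  unfolding psize_def by (intro sum.mono_neutral_left at_most_rows_support) auto

lemma plength_le_iff:
  assumes "is_partition \<nu>"
  shows "plength \<nu> \<le> d \<longleftrightarrow> at_most_rows d \<nu>"
proof
  assume "at_most_rows d \<nu>"
  then show "plength \<nu> \<le> d"
    using card_mono[OF _ at_most_rows_support[of d \<nu>]] by (simp add: plength_def)
next
  assume le: "plength \<nu> \<le> d"
  have "\<nu> i = 0" if "i \<ge> d" for i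
  proof (rule ccontr)
    assume "\<nu> i \<noteq> 0"
    \<comment> \<open>By monotonicity the nonzero rows form an initial segment, so a nonzero row
      \<open>i\<close> forces more than \<open>i\<close> of them.\<close>
    then have "\<nu> j \<noteq> 0" if "j \<le> i" for j
      using assms that by (metis antimonoD is_partition_def le_zero_eq)
    then have "{..i} \<subseteq> {j. \<nu> j \<noteq> 0}" by auto
    then have "card {..i} \<le> plength \<nu>"
      unfolding plength_def by (rule card_mono[rotated]) (use assms in \<open>simp add: is_partition_def\<close>)
    then show False using le that by simp
  qed
  then show "at_most_rows d \<nu>" using assms by (simp add: at_most_rows_def is_partition_def)
qed

text \<open>The staircase shift makes the parts distinct. If all \<open>d\<close> rows are nonzero,
  these are the hook lengths of the first column.\<close>

definition beta_number :: "nat \<Rightarrow> (nat \<Rightarrow> nat) \<Rightarrow> nat \<Rightarrow> nat" where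
  "beta_number d \<nu> i = \<nu> i + (d - 1 - i)"

lemma beta_number_strict:
  assumes "antimono \<nu>" "i < j" "j < d"
  shows "beta_number d \<nu> j < beta_number d \<nu> i"
proof -
  have "\<nu> j \<le> \<nu> i" using assms by (simp add: antimonoD)
  then show ?thesis using assms by (simp add: beta_number_def)
qed

lemma inj_on_beta_number: "antimono \<nu> \<Longrightarrow> inj_on (beta_number d \<nu>) {..<d}"
  by (rule linorder_inj_onI') (metis beta_number_strict lessThan_iff less_irrefl)

lemma sum_beta_number:
  assumes "at_most_rows d \<nu>"
  shows "(\<Sum>i<d. real (beta_number d \<nu> i)) = psize \<nu> + (\<Sum>k<d. real k)"
proof -
  have "(\<Sum>i<d. real (d - Suc i)) = (\<Sum>k<d. real k)" by (rule sum.nat_diff_reindex)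
  then show ?thesis
    unfolding beta_number_def psize_eq_sum[OF assms]
    by (simp only: of_nat_add of_nat_sum sum.distrib diff_diff_left plus_1_eq_Suc)
qed

text \<open>These are the beta numbers of the empty partition, so this is the base case of the
  dimension formula.\<close>

lemma vdm_staircase: "vdm {..<d} (\<lambda>i. real (d - 1 - i)) = (\<Prod>i<d. fact (d - 1 - i))"
proof -
  have "vdm {..<d} real = (\<Prod>i<d. fact i)"
  proof (induction d)
    case (Suc d)
    have "(\<Prod>j<d. \<bar>real d - real j\<bar>) = (\<Prod>j<d. real (d - Suc j + 1))"
      by (intro prod.cong) (auto simp: of_nat_diff)
    also have "\<dots> = (\<Prod>j<d. real (j + 1))" by (rule prod.nat_diff_reindex)
    also have "\<dots> = fact d" by (induction d) (auto simp: algebra_simps)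
    finally show ?case using Suc by (simp add: lessThan_Suc vdm_insert)
  qed (simp)
  moreover have "vdm {..<d} (\<lambda>i. real (d - 1 - i)) = vdm {..<d} real"
    unfolding vdm_def
    by (rule prod.reindex_bij_witness[of _ "\<lambda>(i, j). (d - 1 - j, d - 1 - i)" "\<lambda>(i, j). (d - 1 - j, d - 1 - i)"])
       auto
  moreover have "(\<Prod>i<d. fact (d - 1 - i) :: real) = (\<Prod>i<d. fact i)"
    using prod.nat_diff_reindex[of fact d] by simp
  ultimately show ?thesis by simp
qed

text \<open>Both sides satisfy the recursion of \<open>pdim_rec\<close>: removing a box from row
  \<open>i\<close> multiplies \<open>F\<close> by
  \<open>?l i * decrement_weight {..<d} ?l i\<close>, and these factors sum to the size of the
  partition.\<close>

lemma frobenius_dimension_formula: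
  assumes "at_most_rows d \<nu>"
  shows "real (pdim \<nu>) = fact (psize \<nu>) * vdm {..<d} (\<lambda>i. real (beta_number d \<nu> i))
           / (\<Prod>i<d. fact (beta_number d \<nu> i))"
  using assms
proof (induction "psize \<nu>" arbitrary: \<nu>)
  case 0
  then have "\<nu> i = 0" for i
    using at_most_rows_is_partition[OF 0(2)] by (auto simp: psize_def is_partition_def)
  then have "\<nu> = (\<lambda>_. 0)" by auto
  then show ?case using 0 vdm_staircase[of d] by (simp add: beta_number_def pdim_empty)
next
  case (Suc n)
  let ?b = "beta_number d \<nu>"
  let ?l = "\<lambda>i. real (?b i)"
  define F where "F = vdm {..<d} ?l / (\<Prod>i<d. fact (?b i))"
  have part: "is_partition \<nu>" and mono: "antimono \<nu>"
    using Suc.prems by (auto simp: at_most_rows_is_partition at_most_rows_def)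
  have corner_less: "i < d" if "i \<in> corners \<nu>" for i
    using that Suc.prems by (cases "i < d") (auto simp: corners_def at_most_rows_def)
  have inj: "inj_on ?l {..<d}" using inj_on_beta_number[OF mono, of d] by (simp add: inj_on_def)
  have rec: "real (pdim (remove_box \<nu> i)) = fact n * F * (?l i * decrement_weight {..<d} ?l i)"
    if i: "i \<in> corners \<nu>" for i
  proof -
    have id: "i < d" and pos: "?b i > 0"
      using corner_less[OF i] i by (auto simp: beta_number_def corners_def)
    have rows: "at_most_rows d (remove_box \<nu> i)"
      using Suc.prems antimono_remove_box[OF mono i] id by (auto simp: at_most_rows_def remove_box_def)
    have beta: "beta_number d (remove_box \<nu> i) = ?b(i := ?b i - 1)"
      using i by (auto simp: beta_number_def remove_box_def corners_def)
    have size: "psize (remove_box \<nu> i) = n" using psize_remove_box[OF part i] Suc.hyps(2) by simp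
    have "(\<Prod>j<d. fact (?b j) :: real) = fact (?b i) * (\<Prod>j\<in>{..<d} - {i}. fact (?b j))"
      using id by (simp add: prod.remove)
    moreover have "(\<Prod>j<d. fact ((?b(i := ?b i - 1)) j) :: real) =
        fact (?b i - 1) * (\<Prod>j\<in>{..<d} - {i}. fact (?b j))"
      using id by (subst prod.remove[of _ i]) (auto intro!: prod.cong)
    moreover have "fact (?b i) = ?l i * fact (?b i - 1)" using pos by (simp add: fact_reduce)
    ultimately have "(\<Prod>j<d. fact (?b j) :: real) = ?l i * (\<Prod>j<d. fact ((?b(i := ?b i - 1)) j))"
      by simp
    moreover have "?l i > 0" "(\<Prod>j<d. fact ((?b(i := ?b i - 1)) j) :: real) > 0"
      using pos by (auto intro!: prod_pos simp del: fun_upd_apply)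
    moreover have "vdm {..<d} (\<lambda>j. real ((?b(i := ?b i - 1)) j)) =
        vdm {..<d} ?l * decrement_weight {..<d} ?l i"
      using id pos inj_on_beta_number[OF mono] by (intro vdm_decrement) auto
    ultimately show ?thesis
      using Suc.hyps(1)[OF size[symmetric] rows]
      unfolding beta size F_def by (simp add: field_simps del: fun_upd_apply)
  qed
  \<comment> \<open>Rows without a corner contribute nothing, so the sum may run over all rows.
    Either \<open>?l i - ?l (Suc i) = 1\<close> kills a factor of the weight, or the last row is
    empty and \<open>?l i = 0\<close>.\<close>
  have "?l i * decrement_weight {..<d} ?l i = 0" if i: "i < d" "i \<notin> corners \<nu>" for i
  proof (cases "Suc i < d")
    case True
    have "\<nu> i = \<nu> (Suc i)" using i mono by (auto simp: corners_def antimono_iff_le_Suc intro: antisym)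
    then have "?l i - ?l (Suc i) = 1" using True by (simp add: beta_number_def of_nat_diff)
    then have "decrement_weight {..<d} ?l i = 0"
      unfolding decrement_weight_def using True by (intro prod_zero bexI[of _ "Suc i"]) auto
    then show ?thesis by simp
  next
    case False
    then have "\<nu> (Suc i) = 0" using Suc.prems by (simp add: at_most_rows_def)
    then show ?thesis using i False by (auto simp: corners_def beta_number_def)
  qed
  then have "(\<Sum>i\<in>corners \<nu>. ?l i * decrement_weight {..<d} ?l i) =
      (\<Sum>i<d. ?l i * decrement_weight {..<d} ?l i)"
    using corner_less by (intro sum.mono_neutral_left) auto
  also have "\<dots> = Suc n"
    using sum_mult_decrement_weight[OF _ inj] sum_beta_number[OF Suc.prems] Suc.hyps(2) by simp
  finally have sum: "(\<Sum>i\<in>corners \<nu>. ?l i * decrement_weight {..<d} ?l i) = Suc n" .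
  have "real (pdim \<nu>) = (\<Sum>i\<in>corners \<nu>. real (pdim (remove_box \<nu> i)))"
    using pdim_rec[OF part] Suc.hyps(2) by simp
  also have "\<dots> = fact n * F * (\<Sum>i\<in>corners \<nu>. ?l i * decrement_weight {..<d} ?l i)"
    by (simp add: rec sum_distrib_left)
  also have "\<dots> = fact (Suc n) * F" unfolding sum by simp
  finally show ?case by (simp add: F_def Suc.hyps(2)[symmetric])
qed

lemma pdim_pos: "at_most_rows d \<nu> \<Longrightarrow> pdim \<nu> > 0"
proof -
  assume rows: "at_most_rows d \<nu>"
  then have "inj_on (\<lambda>i. real (beta_number d \<nu> i)) {..<d}"
    using inj_on_beta_number[of \<nu> d] by (simp add: inj_on_def at_most_rows_def)
  then have "real (pdim \<nu>) > 0"
    unfolding frobenius_dimension_formula[OF rows] by (simp add: vdm_pos prod_pos)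
  then show ?thesis by simp
qed

subsection \<open>Estimates for factorials\<close>

lemma abs_diff_le_telescope:
  fixes f :: "nat \<Rightarrow> real"
  assumes "a \<le> b" and "\<And>k. a \<le> k \<Longrightarrow> k < b \<Longrightarrow> \<bar>f (Suc k) - f k\<bar> \<le> c"
  shows "\<bar>f b - f a\<bar> \<le> (real b - real a) * c"
  using assms
proof (induction b rule: dec_induct)
  case (step b)
  have "\<bar>f b - f a\<bar> \<le> (real b - real a) * c" "\<bar>f (Suc b) - f b\<bar> \<le> c"
    using step by auto
  then show ?case by (simp add: algebra_simps)
qed simp

text \<open>The error \<open>f\<close> vanishes at \<open>n\<close>, and each of the at most
  \<open>M\<close> unit steps from \<open>n\<close> to \<open>m\<close> changes it by at most
  \<open>c\<close>.\<close>

lemma ln_fact_approx: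
  fixes m n :: nat and M :: real
  assumes "n > 0" and "\<bar>real m - real n\<bar> \<le> M" and "M \<le> real n / 2"
  shows "\<bar>ln (fact m) - ln (fact n) - (real m - real n) * ln (real n) - (real m - real n)\<^sup>2 / (2 * real n)\<bar>
           \<le> M * (2 * M\<^sup>2 / (real n)\<^sup>2 + 1 / (2 * real n))"
proof -
  define f where "f k = ln (fact k) - (real k - real n) * ln (real n) - (real k - real n)\<^sup>2 / (2 * real n)" for k
  define c where "c = 2 * M\<^sup>2 / (real n)\<^sup>2 + 1 / (2 * real n)"
  have c: "c \<ge> 0" by (simp add: c_def)
  have step: "\<bar>f (Suc k) - f k\<bar> \<le> c" if "\<bar>real (Suc k) - real n\<bar> \<le> M" for k
  proof -
    \<comment> \<open>The relative deviation of the new factor \<open>Suc k\<close> from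
      \<open>n\<close>; the bound on \<open>M\<close> keeps it within 1/2, where
      \<open>ln (1 + t)\<close> is \<open>t\<close> up to \<open>2 * t\<^sup>2\<close>.\<close>
    define t where "t = (real (Suc k) - real n) / real n"
    have tM: "\<bar>t\<bar> \<le> M / real n" unfolding t_def using that assms(1) by (simp add: divide_right_mono)
    have "M / real n \<le> 1 / 2" using assms by (simp add: field_simps)
    then have "\<bar>t\<bar> \<le> 1 / 2" using tM by linarith
    then have "\<bar>ln (1 + t) - t\<bar> \<le> 2 * t\<^sup>2" by (rule abs_ln_one_plus_x_minus_x_bound)
    moreover have "t\<^sup>2 \<le> (M / real n)\<^sup>2" using tM by (metis abs_ge_zero power2_abs power_mono)
    moreover have "1 + t = real (Suc k) / real n" using assms(1) by (simp add: t_def field_simps)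
    then have "ln (1 + t) = ln (real (Suc k)) - ln (real n)" using assms(1) by (simp add: ln_div)
    moreover have "f (Suc k) - f k = ln (real (Suc k)) - ln (real n) - t + 1 / (2 * real n)"
    proof -
      have "ln (fact (Suc k)) = ln (real (Suc k)) + ln (fact k :: real)"
        by (simp add: ln_mult del: of_nat_Suc)
      \<comment> \<open>The increment of the quadratic term cancels \<open>t\<close> and leaves the
        discretisation error \<open>1 / (2 * real n)\<close>.\<close>
      moreover have "(real (Suc k) - real n)\<^sup>2 / (2 * real n) - (real k - real n)\<^sup>2 / (2 * real n) =
          t - 1 / (2 * real n)"
        using assms(1) by (simp add: t_def field_simps power2_eq_square)
      ultimately show ?thesis by (simp add: f_def algebra_simps)
    qed
    moreover have "1 / (2 * real n) \<ge> 0" by simp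
    ultimately have "\<bar>f (Suc k) - f k\<bar> \<le> 2 * (M / real n)\<^sup>2 + 1 / (2 * real n)" by linarith
    then show ?thesis by (simp add: c_def power_divide)
  qed
  have "\<bar>f m - f n\<bar> \<le> \<bar>real m - real n\<bar> * c"
  proof (cases "n \<le> m")
    case True
    then have "\<bar>f m - f n\<bar> \<le> (real m - real n) * c"
      using assms(2) by (intro abs_diff_le_telescope step) auto
    then show ?thesis using True by simp
  next
    case False
    then have "\<bar>f n - f m\<bar> \<le> (real n - real m) * c"
      using assms(2) by (intro abs_diff_le_telescope step) auto
    then show ?thesis using False by (simp add: abs_minus_commute)
  qed
  also have "\<dots> \<le> M * c" using assms(2) c by (rule mult_right_mono)
  finally show ?thesis by (simp add: f_def c_def algebra_simps)
qed

text \<open>Each factor satisfies \<open>n - j \<le> n * exp (- j / n)\<close>, and the exponents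
  for \<open>j < k\<close> add up to \<open>k * (k - 1) / (2 * n)\<close>.\<close>

lemma fact_le_fact_diff:
  assumes "k \<le> n"
  shows "fact n \<le> fact (n - k) * real n ^ k * exp (- (real k * (real k - 1) / (2 * real n)))"
  using assms
proof (induction k)
  case (Suc k)
  then have n: "n > 0" and nk: "n - k = Suc (n - Suc k)" by auto
  have "real (n - k) \<le> real n * exp (- (real k / real n))"
    using exp_ge_add_one_self[of "- (real k / real n)"] n Suc.prems
    by (simp add: field_simps of_nat_diff)
  moreover have "fact (n - k) = real (n - k) * fact (n - Suc k)" unfolding nk by simp
  ultimately have "fact (n - k) \<le> real n * exp (- (real k / real n)) * fact (n - Suc k)"
    by (simp add: mult_right_mono)
  then have "fact (n - k) * (real n ^ k * exp (- (real k * (real k - 1) / (2 * real n)))) \<le>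
     (real n * exp (- (real k / real n)) * fact (n - Suc k)) *
       (real n ^ k * exp (- (real k * (real k - 1) / (2 * real n))))"
    by (intro mult_right_mono) auto
  also have "\<dots> = fact (n - Suc k) * real n ^ Suc k *
      (exp (- (real k / real n)) * exp (- (real k * (real k - 1) / (2 * real n))))"
    by simp
  also have "exp (- (real k / real n)) * exp (- (real k * (real k - 1) / (2 * real n))) =
      exp (- (real (Suc k) * (real (Suc k) - 1) / (2 * real n)))"
    unfolding exp_add[symmetric] using n by (simp add: field_simps)
  finally have "fact (n - k) * real n ^ k * exp (- (real k * (real k - 1) / (2 * real n))) \<le>
      fact (n - Suc k) * real n ^ Suc k * exp (- (real (Suc k) * (real (Suc k) - 1) / (2 * real n)))"
    by (simp only: mult.assoc)
  then show ?case using Suc by linarith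
qed simp

lemma fact_mult_power_le: "fact n * real n ^ k \<le> fact (n + k)"
proof (induction k)
  case (Suc k)
  have "fact n * real n ^ Suc k = real n * (fact n * real n ^ k)" by simp
  also have "\<dots> \<le> real (Suc (n + k)) * fact (n + k)" using Suc by (intro mult_mono) auto
  finally show ?case by simp
qed simp

lemma fact_add_le_power: "fact (n + k) \<le> (fact n * real (n + k) ^ k :: real)"
proof (induction k)
  case (Suc k)
  have "real (n + k) ^ k \<le> real (n + Suc k) ^ k" by (intro power_mono) auto
  then have "fact n * real (n + k) ^ k \<le> (fact n * real (n + Suc k) ^ k :: real)"
    by (intro mult_left_mono) auto
  with Suc have "fact (n + k) \<le> (fact n * real (n + Suc k) ^ k :: real)" by (rule order_trans)
  then have "real (n + Suc k) * fact (n + k) \<le> real (n + Suc k) * (fact n * real (n + Suc k) ^ k)"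
    by (rule mult_left_mono) simp
  then show ?case by (simp add: algebra_simps)
qed simp

text \<open>One formula with a signed exponent covers short and long rows alike, so the powers of
  \<open>n\<close> cancel once the deviations sum to zero.\<close>

lemma fact_ratio_le_powr:
  assumes "n > 0"
  shows "fact n / fact m \<le> real n powr (real n - real m)"
proof (cases "m \<le> n")
  case True
  then have "fact n \<le> fact m * real n ^ (n - m) * exp (- (real (n - m) * (real (n - m) - 1) / (2 * real n)))"
    using fact_le_fact_diff[of "n - m" n] by simp
  also have "real (n - m) * (real (n - m) - 1) \<ge> 0" by (cases "n - m") simp_all
  then have "fact m * real n ^ (n - m) * exp (- (real (n - m) * (real (n - m) - 1) / (2 * real n))) \<le>
      fact m * real n ^ (n - m) * 1"
    by (intro mult_left_mono) simp_all
  also have "real n ^ (n - m) = real n powr (real n - real m)"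
    using assms True by (simp add: powr_realpow[symmetric] of_nat_diff)
  finally show ?thesis by (simp add: field_simps)
next
  case False
  then have "fact n * real n ^ (m - n) \<le> fact m" using fact_mult_power_le[of n "m - n"] by simp
  moreover have "real n ^ (m - n) = real n powr (real m - real n)"
    using assms False by (simp add: powr_realpow[symmetric] of_nat_diff)
  ultimately have "fact n * real n powr (real m - real n) \<le> fact m" by simp
  moreover have "real n powr (real n - real m) = inverse (real n powr (real m - real n))"
    using powr_minus[of "real n" "real m - real n"] by simp
  moreover have "fact n / fact m \<le> inverse p" if "fact n * p \<le> fact m" "p > 0" for p :: real
    using that by (simp add: field_simps)
  ultimately show ?thesis using assms by simp
qed

text \<open>The Gaussian factor of \<open>fact_le_fact_diff\<close> is kept. It may be evaluated at
  any \<open>s\<close> from 1 up to the deficit, since \<open>s * (s - 1)\<close> increases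
  there.\<close>

lemma fact_ratio_le_powr_exp:
  assumes "n > 0" and "1 \<le> s" and "s \<le> real n - real m"
  shows "fact n / fact m \<le> real n powr (real n - real m) * exp (- (s * (s - 1) / (2 * real n)))"
proof -
  have mn: "m \<le> n" using assms by simp
  then have "fact n \<le> fact m * real n ^ (n - m) * exp (- (real (n - m) * (real (n - m) - 1) / (2 * real n)))"
    using fact_le_fact_diff[of "n - m" n] by simp
  also have "\<dots> \<le> fact m * real n ^ (n - m) * exp (- (s * (s - 1) / (2 * real n)))"
    using assms mn by (intro mult_left_mono) (auto intro!: divide_right_mono mult_mono simp: of_nat_diff)
  also have "real n ^ (n - m) = real n powr (real n - real m)"
    using assms mn by (simp add: powr_realpow[symmetric] of_nat_diff)
  finally show ?thesis by (simp add: field_simps)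
qed

text \<open>A single short row \<open>k\<close> supplies the exponential factor; all other rows use
  the plain bound.\<close>

lemma prod_fact_ratio_le_exp:
  assumes "n > 0" and "finite J" and "(\<Sum>i\<in>J. real n - real (\<nu> i)) = 0"
    and "k \<in> J" and "1 \<le> s" and "s \<le> real n - real (\<nu> k)"
  shows "(\<Prod>i\<in>J. fact n / fact (\<nu> i)) \<le> exp (- (s * (s - 1) / (2 * real n)))"
proof -
  let ?e = "exp (- (s * (s - 1) / (2 * real n)))"
  have "(\<Prod>i\<in>J. fact n / fact (\<nu> i)) \<le>
      (\<Prod>i\<in>J. real n powr (real n - real (\<nu> i)) * (if i = k then ?e else 1))"
    using fact_ratio_le_powr[OF assms(1)] fact_ratio_le_powr_exp[OF assms(1,5,6)]
    by (intro prod_mono) auto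
  also have "\<dots> = real n powr (\<Sum>i\<in>J. real n - real (\<nu> i)) * ?e"
    using assms(1,2,4) by (subst powr_sum) (simp_all add: prod.distrib)
  also have "\<dots> = ?e" using assms by simp
  finally show ?thesis .
qed

text \<open>The logarithm consists of terms of order \<open>ln n\<close> minus a multiple of
  \<open>n powr (1/5)\<close>, hence tends to minus infinity.\<close>

lemma tendsto_polynomial_times_exp_neg:
  fixes a b c e \<beta> :: real
  assumes "a > 0" "b > 0" "\<beta> > 0"
  shows "(\<lambda>n. (a * real n + 1) powr c * ((a * real n + a) powr e *
      exp (- (real n powr (3/5) / b * (real n powr (3/5) / b - 1) / (2 * real n)))) powr \<beta>) \<longlonglongrightarrow> 0"
proof -
  let ?f = "\<lambda>n. c * ln (a * real n + 1) + \<beta> * e * ln (a * real n + a) -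
      \<beta> * (real n powr (3/5) / b * (real n powr (3/5) / b - 1) / (2 * real n))"
  have "(\<lambda>n. exp (?f n)) \<longlonglongrightarrow> 0"
    by (rule filterlim_compose[OF exp_at_bot]) (use assms in real_asymp)
  moreover have "exp (?f n) = (a * real n + 1) powr c * ((a * real n + a) powr e *
      exp (- (real n powr (3/5) / b * (real n powr (3/5) / b - 1) / (2 * real n)))) powr \<beta>" for n
  proof -
    have "a * real n + 1 > 0" "a * real n + a > 0" using assms by (auto intro: add_nonneg_pos)
    then show ?thesis
      by (simp add: powr_def ln_mult exp_add[symmetric] algebra_simps)
  qed
  ultimately show ?thesis by simp
qed

lemma tendsto_window_error:
  fixes d \<beta> :: real
  assumes "d > 0"
  shows "(\<lambda>n. exp (\<beta> * (2 * d * ((real n powr (3/5) + d) *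
      (2 * (real n powr (3/5) + d)\<^sup>2 / (real n)\<^sup>2 + 1 / (2 * real n))))) - 1) \<longlonglongrightarrow> 0"
proof -
  have "(\<lambda>n. (real n powr (3/5) + d) *
      (2 * (real n powr (3/5) + d)\<^sup>2 / (real n)\<^sup>2 + 1 / (2 * real n))) \<longlonglongrightarrow> 0"
    using assms by real_asymp
  then have "(\<lambda>n. exp (\<beta> * (2 * d * ((real n powr (3/5) + d) *
      (2 * (real n powr (3/5) + d)\<^sup>2 / (real n)\<^sup>2 + 1 / (2 * real n))))) - 1) \<longlonglongrightarrow> exp (\<beta> * (2 * d * 0)) - 1"
    by (intro tendsto_intros)
  then show ?thesis by simp
qed

subsection \<open>The two index sets\<close>

definition strip :: "nat \<Rightarrow> nat \<Rightarrow> (nat \<Rightarrow> nat) set" where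
  "strip d m = {\<nu>. at_most_rows d \<nu> \<and> psize \<nu> = m}"

definition boxed :: "nat \<Rightarrow> nat \<Rightarrow> nat \<Rightarrow> (nat \<Rightarrow> nat) set" where
  "boxed d q m = {\<nu> \<in> strip d m. \<forall>i. \<nu> i \<le> q}"

lemma strip_eq: "{\<nu>. \<nu> \<turnstile> m \<and> plength \<nu> \<le> d} = strip d m"
  using plength_le_iff at_most_rows_is_partition by (auto simp: strip_def partition_of_def)

lemma boxed_eq: "{\<mu>. \<mu> \<turnstile> m \<and> diagram \<mu> \<subseteq> diagram (rectangle d q)} = boxed d q m"
proof -
  have "diagram \<mu> \<subseteq> diagram (rectangle d q) \<longleftrightarrow> (\<forall>i. \<mu> i \<le> rectangle d q i)" for \<mu>
  proof -
    have "(\<forall>j. j < x \<longrightarrow> j < y) \<longleftrightarrow> x \<le> y" for x y :: nat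
      by (metis less_irrefl less_le_trans not_less)
    then show ?thesis by (simp add: diagram_def subset_iff)
  qed
  moreover have "(\<forall>i. \<mu> i \<le> rectangle d q i) \<longleftrightarrow> (\<forall>i\<ge>d. \<mu> i = 0) \<and> (\<forall>i. \<mu> i \<le> q)" for \<mu>
    by (auto simp: rectangle_def not_less) (metis le0 not_le)
  ultimately show ?thesis
    using at_most_rows_is_partition
    by (auto simp: boxed_def strip_def partition_of_def at_most_rows_def is_partition_def)
qed

lemma strip_part_le: "\<nu> \<in> strip d m \<Longrightarrow> \<nu> i \<le> m"
proof (cases "i < d")
  case True
  assume "\<nu> \<in> strip d m"
  then have "(\<Sum>i<d. \<nu> i) = m" by (auto simp: strip_def psize_eq_sum)
  then show ?thesis using member_le_sum[of i "{..<d}" \<nu>] True by simp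
qed (auto simp: strip_def at_most_rows_def)

text \<open>A member is determined by its first \<open>d\<close> values, each at most
  \<open>m\<close>. The bound is polynomial in \<open>m\<close> because \<open>d\<close> is
  fixed.\<close>

lemma finite_strip: "finite (strip d m)"
  and card_strip_le: "card (strip d m) \<le> (m + 1) ^ d"
proof -
  let ?r = "\<lambda>\<nu>. restrict \<nu> {..<d}"
  have inj: "inj_on ?r (strip d m)"
  proof (rule inj_onI)
    fix \<mu> \<nu> assume *: "\<mu> \<in> strip d m" "\<nu> \<in> strip d m" "?r \<mu> = ?r \<nu>"
    show "\<mu> = \<nu>"
    proof
      fix i show "\<mu> i = \<nu> i"
        using *(1,2) fun_cong[OF *(3), of i] by (cases "i < d") (auto simp: strip_def at_most_rows_def)
    qed
  qed
  have sub: "?r ` strip d m \<subseteq> PiE {..<d} (\<lambda>_. {..m})"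
    using strip_part_le by (auto simp: PiE_def)
  have fin: "finite (PiE {..<d} (\<lambda>_. {..m}))" by (intro finite_PiE) auto
  show "finite (strip d m)" using finite_imageD[OF finite_subset[OF sub fin] inj] .
  have "card (strip d m) \<le> card (PiE {..<d} (\<lambda>_. {..m}))"
    using card_mono[OF fin sub] by (simp add: card_image[OF inj])
  then show "card (strip d m) \<le> (m + 1) ^ d" by (simp add: card_PiE)
qed

lemma sum_deviation:
  assumes "\<nu> \<in> strip d (d * n)"
  shows "(\<Sum>i<d. real n - real (\<nu> i)) = 0"
proof -
  have "(\<Sum>i<d. real (\<nu> i)) = real (d * n)"
    using assms by (auto simp: strip_def psize_eq_sum simp flip: of_nat_sum)
  then show ?thesis by (simp add: sum_subtractf)
qed

lemma rectangle_in_strip: "rectangle d n \<in> strip d (d * n)"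
proof -
  have "at_most_rows d (rectangle d n)" by (auto simp: at_most_rows_def rectangle_def antimono_def)
  then show ?thesis by (simp add: strip_def psize_eq_sum) (simp add: rectangle_def)
qed

subsection \<open>Complements of partitions near the rectangle\<close>

text \<open>The width \<open>2 * n\<close> is twice the mean row length, so complementation
  preserves the size \<open>d * n\<close> and is an involution of the index set.\<close>

lemma complement_in_boxed:
  assumes "\<mu> \<in> boxed d (2 * n) (d * n)"
  shows "complement_in d (2 * n) \<mu> \<in> boxed d (2 * n) (d * n)"
    and "complement_in d (2 * n) (complement_in d (2 * n) \<mu>) = \<mu>"
proof -
  let ?c = "complement_in d (2 * n) \<mu>"
  have mono: "antimono \<mu>" and zero: "\<And>i. i \<ge> d \<Longrightarrow> \<mu> i = 0" and le: "\<And>i. \<mu> i \<le> 2 * n"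
    and size: "(\<Sum>i<d. \<mu> i) = d * n"
    using assms by (auto simp: boxed_def strip_def at_most_rows_def psize_eq_sum[symmetric])
  have rows: "at_most_rows d ?c"
    unfolding at_most_rows_def
  proof
    show "antimono ?c"
    proof (rule antimonoI)
      fix i j :: nat assume "i \<le> j"
      then show "?c j \<le> ?c i"
        using antimonoD[OF mono, of "d - 1 - j" "d - 1 - i"] by (auto simp: complement_in_def intro: diff_le_mono2)
    qed
  qed (simp add: complement_in_def)
  have "psize ?c = (\<Sum>i<d. 2 * n - \<mu> (d - 1 - i))"
    unfolding psize_eq_sum[OF rows] by (simp add: complement_in_def)
  also have "\<dots> = (\<Sum>i<d. 2 * n - \<mu> i)" using sum.nat_diff_reindex[of "\<lambda>i. 2 * n - \<mu> i" d] by simp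
  also have "\<dots> = d * n"
    using size le by (subst sum_subtractf_nat) auto
  finally show "?c \<in> boxed d (2 * n) (d * n)"
    using rows by (auto simp: boxed_def strip_def complement_in_def)
  show "complement_in d (2 * n) ?c = \<mu>"
    using zero le by (auto simp: complement_in_def fun_eq_iff)
qed

lemma beta_number_complement:
  assumes "\<mu> \<in> boxed d (2 * n) (d * n)" "i < d"
  shows "beta_number d (complement_in d (2 * n) \<mu>) i + beta_number d \<mu> (d - 1 - i) = 2 * n + (d - 1)"
proof -
  have "\<mu> (d - 1 - i) \<le> 2 * n" using assms by (auto simp: boxed_def)
  then show ?thesis using assms(2) by (simp add: beta_number_def complement_in_def)
qed

text \<open>Complementation reverses the differences of the beta numbers, so only the factorials change.\<close>

lemma vdm_complement:
  assumes "\<mu> \<in> boxed d (2 * n) (d * n)"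
  shows "vdm {..<d} (\<lambda>i. real (beta_number d (complement_in d (2 * n) \<mu>) i)) =
         vdm {..<d} (\<lambda>i. real (beta_number d \<mu> i))"
proof -
  have b: "real (beta_number d (complement_in d (2 * n) \<mu>) i) =
      real (2 * n + (d - 1)) - real (beta_number d \<mu> (d - 1 - i))" if "i < d" for i
    using beta_number_complement[OF assms that] by linarith
  show ?thesis
    unfolding vdm_def
    by (rule prod.reindex_bij_witness[of _ "\<lambda>(i, j). (d - 1 - j, d - 1 - i)" "\<lambda>(i, j). (d - 1 - j, d - 1 - i)"])
       (auto simp: b)
qed

text \<open>In the difference of the two dimension formulas the factorial of the size and the
  Vandermonde products cancel.\<close>

lemma ln_pdim_complement:
  assumes "\<mu> \<in> boxed d (2 * n) (d * n)"
  shows "ln (pdim (complement_in d (2 * n) \<mu>)) - ln (pdim \<mu>) =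
     (\<Sum>i<d. ln (fact (beta_number d \<mu> i)) - ln (fact (2 * n + (d - 1) - beta_number d \<mu> i)))"
proof -
  let ?c = "complement_in d (2 * n) \<mu>"
  have ln_pdim: "ln (pdim \<nu>) = ln (fact (d * n)) + ln (vdm {..<d} (\<lambda>i. real (beta_number d \<nu> i)))
      - (\<Sum>i<d. ln (fact (beta_number d \<nu> i)))" if "\<nu> \<in> boxed d (2 * n) (d * n)" for \<nu>
  proof -
    have rows: "at_most_rows d \<nu>" and size: "psize \<nu> = d * n"
      using that by (auto simp: boxed_def strip_def)
    have "vdm {..<d} (\<lambda>i. real (beta_number d \<nu> i)) > 0"
      using inj_on_beta_number[of \<nu> d] rows by (intro vdm_pos) (auto simp: inj_on_def at_most_rows_def)
    moreover have "(\<Prod>i<d. fact (beta_number d \<nu> i) :: real) > 0" by (simp add: prod_pos)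
    ultimately show ?thesis
      unfolding frobenius_dimension_formula[OF rows] size
      by (simp add: ln_div ln_mult ln_prod)
  qed
  have "(\<Sum>i<d. ln (fact (beta_number d ?c i)) :: real) =
      (\<Sum>i<d. ln (fact (2 * n + (d - 1) - beta_number d \<mu> (d - 1 - i))))"
  proof (intro sum.cong refl)
    fix i assume "i \<in> {..<d}"
    then have "beta_number d ?c i = 2 * n + (d - 1) - beta_number d \<mu> (d - 1 - i)"
      using beta_number_complement[OF assms, of i] by simp
    then show "ln (fact (beta_number d ?c i)) = ln (fact (2 * n + (d - 1) - beta_number d \<mu> (d - 1 - i)) :: real)"
      by simp
  qed
  also have "\<dots> = (\<Sum>i<d. ln (fact (2 * n + (d - 1) - beta_number d \<mu> i)))"
    using sum.nat_diff_reindex[of "\<lambda>i. ln (fact (2 * n + (d - 1) - beta_number d \<mu> i) :: real)" d] by simp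
  finally show ?thesis
    using ln_pdim[OF assms] ln_pdim[OF complement_in_boxed(1)[OF assms]] vdm_complement[OF assms]
    by (simp add: sum_subtractf)
qed

text \<open>Both factorials of each row are expanded around \<open>n\<close>; the main terms
  \<open>q\<close> cancel after summation, leaving two errors of size \<open>c\<close> per
  row.\<close>

lemma abs_ln_pdim_complement_le:
  fixes r :: real
  assumes "\<mu> \<in> boxed d (2 * n) (d * n)" and "n > 0"
    and dev: "\<And>i. i < d \<Longrightarrow> \<bar>real (\<mu> i) - real n\<bar> \<le> r" and small: "r + real d \<le> real n / 2"
  shows "\<bar>ln (pdim (complement_in d (2 * n) \<mu>)) - ln (pdim \<mu>)\<bar> \<le>
     2 * real d * ((r + real d) * (2 * (r + real d)\<^sup>2 / (real n)\<^sup>2 + 1 / (2 * real n)))"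
proof -
  define c where "c = (r + real d) * (2 * (r + real d)\<^sup>2 / (real n)\<^sup>2 + 1 / (2 * real n))"
  define b where "b = beta_number d \<mu>"
  define b' where "b' i = 2 * n + (d - 1) - b i" for i
  define q where "q x = x * ln (real n) + x\<^sup>2 / (2 * real n)" for x :: real
  define k where "k i = real (b i) - real n" for i
  have strip: "\<mu> \<in> strip d (d * n)" and rows: "at_most_rows d \<mu>" and size: "psize \<mu> = d * n"
    using assms(1) by (auto simp: boxed_def strip_def)
  have b': "real (b' i) - real n = real (d - 1) - k i" and kd: "\<bar>k i\<bar> \<le> r + real d"
    and kd': "\<bar>real (d - 1) - k i\<bar> \<le> r + real d" if "i < d" for i
  proof -
    have "\<mu> i \<le> 2 * n" using assms(1) by (auto simp: boxed_def)
    then have "b i \<le> 2 * n + (d - 1)" by (simp add: b_def beta_number_def)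
    then show "real (b' i) - real n = real (d - 1) - k i" by (simp add: b'_def k_def of_nat_diff)
    \<comment> \<open>The staircase shift adds at most \<open>d - 1\<close> to the deviation, hence
      the radius \<open>r + d\<close>.\<close>
    have "k i = real (\<mu> i) - real n + (real d - 1 - real i)"
      using that by (simp add: k_def b_def beta_number_def of_nat_diff)
    then show "\<bar>k i\<bar> \<le> r + real d" "\<bar>real (d - 1) - k i\<bar> \<le> r + real d"
      using dev[OF that] that by (auto simp: of_nat_diff)
  qed
  have approx: "\<bar>ln (fact (b i)) - ln (fact (b' i)) - (q (k i) - q (real (d - 1) - k i))\<bar> \<le> 2 * c" if "i < d" for i
  proof -
    have "\<bar>ln (fact (b i)) - ln (fact n) - q (k i)\<bar> \<le> c"
      using ln_fact_approx[OF assms(2), of "b i" "r + real d"] kd[OF that] small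
      by (simp add: c_def q_def k_def algebra_simps)
    moreover have "\<bar>ln (fact (b' i)) - ln (fact n) - q (real (d - 1) - k i)\<bar> \<le> c"
      using ln_fact_approx[OF assms(2), of "b' i" "r + real d"] kd'[OF that] small
      unfolding b'[OF that] by (simp add: c_def q_def algebra_simps)
    ultimately show ?thesis by linarith
  qed
  have "2 * (\<Sum>i<d. real i) = real d * (real d - 1)" by (induction d) (auto simp: algebra_simps)
  then have gauss: "2 * (\<Sum>i<d. real i) = real d * real (d - 1)" by (cases d) auto
  have "(\<Sum>i<d. k i) = (\<Sum>i<d. real i)"
    using sum_beta_number[OF rows] size by (simp add: k_def b_def sum_subtractf)
  then have k0: "(\<Sum>i<d. 2 * k i - real (d - 1)) = 0"
    using gauss by (cases d) (simp_all add: sum_subtractf flip: sum_distrib_left)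
  \<comment> \<open>The squares of \<open>k i\<close> cancel, so the difference is affine in
    \<open>k i\<close>: a constant times \<open>2 * k i - (d - 1)\<close>, which sums to zero by
    \<open>k0\<close>.\<close>
  have "q (k i) - q (real (d - 1) - k i) = (2 * k i - real (d - 1)) * (ln (real n) + real (d - 1) / (2 * real n))" for i
    using assms(2) by (simp add: q_def field_simps power2_eq_square)
  then have zero: "(\<Sum>i<d. q (k i) - q (real (d - 1) - k i)) = 0"
    by (simp only: sum_distrib_right[symmetric] k0 mult_zero_left)
  have "ln (pdim (complement_in d (2 * n) \<mu>)) - ln (pdim \<mu>) = (\<Sum>i<d. ln (fact (b i)) - ln (fact (b' i)))"
    unfolding ln_pdim_complement[OF assms(1)] b_def b'_def ..
  also have "\<dots> = (\<Sum>i<d. ln (fact (b i)) - ln (fact (b' i)) - (q (k i) - q (real (d - 1) - k i)))"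
    using zero by (simp add: sum_subtractf)
  finally have "\<bar>ln (pdim (complement_in d (2 * n) \<mu>)) - ln (pdim \<mu>)\<bar> \<le>
      (\<Sum>i<d. \<bar>ln (fact (b i)) - ln (fact (b' i)) - (q (k i) - q (real (d - 1) - k i))\<bar>)"
    by simp
  also have "\<dots> \<le> (\<Sum>i<d. 2 * c)" using approx by (intro sum_mono) auto
  also have "\<dots> = 2 * real d * c" by simp
  finally show ?thesis unfolding c_def .
qed

subsection \<open>Partitions far from the rectangle\<close>

text \<open>The dimension formulas of \<open>\<nu>\<close> and of the rectangle are compared factor
  by factor. The Vandermonde product and the staircase shifts in the factorials each cost at most
  \<open>K ^ (d * d)\<close>.\<close>

lemma pdim_tail_le:
  fixes s :: real
  assumes "\<nu> \<in> strip d (d * n)" and "n > 0" and "k < d" and "1 \<le> s" and "s \<le> real n - real (\<nu> k)"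
  shows "real (pdim \<nu>) \<le> real (pdim (rectangle d n)) *
     (real (d * n + d) ^ (2 * (d * d)) * exp (- (s * (s - 1) / (2 * real n))))"
proof -
  define K where "K = real (d * n + d)"
  define b where "b = beta_number d \<nu>"
  define b0 where "b0 = beta_number d (rectangle d n)"
  have "d * n + d \<ge> 1" using assms(3) by simp
  then have K1: "K \<ge> 1" unfolding K_def by linarith
  have "n + d \<le> d * n + d" using assms(3) by simp
  then have nK: "real n + real d \<le> K" by (simp add: K_def flip: of_nat_add)
  have rows: "at_most_rows d \<nu>" and size: "psize \<nu> = d * n"
    using assms(1) by (auto simp: strip_def)
  have rows0: "at_most_rows d (rectangle d n)" and size0: "psize (rectangle d n) = d * n"
    using rectangle_in_strip[of d n] by (auto simp: strip_def)
  have b_le: "real (b i) \<le> K" if "i < d" for i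
    using strip_part_le[OF assms(1), of i] that by (auto simp: b_def beta_number_def K_def simp flip: of_nat_add)
  have diff_le: "\<bar>real (b i) - real (b j)\<bar> \<le> K" if "i < d" "j < d" for i j
    using b_le[OF that(1)] b_le[OF that(2)] by linarith
  have "card {(i, j). i \<in> {..<d} \<and> j \<in> {..<d} \<and> i < j} \<le> card ({..<d} \<times> {..<d})"
    by (intro card_mono) auto
  then have vdm_le: "vdm {..<d} (\<lambda>i. real (b i)) \<le> K ^ (d * d)"
    unfolding vdm_def using K1 diff_le by (intro prod_le_power) auto
  \<comment> \<open>The differences of the rectangle's beta numbers are \<open>j - i\<close>, hence
    at least 1.\<close>
  have vdm0_ge: "1 \<le> vdm {..<d} (\<lambda>i. real (b0 i))"
    unfolding vdm_def by (intro prod_ge_1) (auto simp: b0_def beta_number_def rectangle_def of_nat_diff)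
  have ratio: "fact (b0 i) / fact (b i) \<le> K ^ d * (fact n / fact (\<nu> i))" if "i < d" for i
  proof -
    have "fact (b0 i) \<le> (fact n * real (b0 i) ^ (d - 1 - i) :: real)"
      using fact_add_le_power[of n "d - 1 - i"] that by (simp add: b0_def beta_number_def rectangle_def)
    also have "real (b0 i) ^ (d - 1 - i) \<le> K ^ (d - 1 - i)"
      using nK that by (intro power_mono) (auto simp: b0_def beta_number_def rectangle_def)
    also have "\<dots> \<le> K ^ d" using K1 by (intro power_increasing) auto
    finally have "fact (b0 i) \<le> fact n * K ^ d" by simp
    moreover have "fact (\<nu> i) \<le> (fact (b i) :: real)" by (intro fact_mono) (simp add: b_def beta_number_def)
    ultimately have "fact (b0 i) / fact (b i) \<le> (fact n * K ^ d) / fact (\<nu> i)"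
      using K1 by (intro frac_le) auto
    then show ?thesis by (simp add: mult.commute)
  qed
  let ?p0 = "real (pdim (rectangle d n))"
  have "real (pdim \<nu>) = (fact (d * n) / (\<Prod>i<d. fact (b0 i))) * vdm {..<d} (\<lambda>i. real (b i)) *
      (\<Prod>i<d. fact (b0 i) / fact (b i))"
    unfolding frobenius_dimension_formula[OF rows] size by (simp add: b_def prod_dividef)
  also have "\<dots> \<le> ?p0 * K ^ (d * d) * (\<Prod>i<d. K ^ d * (fact n / fact (\<nu> i)))"
  proof (intro mult_mono prod_mono vdm_le)
    show "fact (d * n) / (\<Prod>i<d. fact (b0 i)) \<le> ?p0"
      unfolding frobenius_dimension_formula[OF rows0] size0 b0_def[symmetric]
      using vdm0_ge by (intro divide_right_mono) (auto intro: prod_nonneg)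
  qed (use ratio K1 in \<open>auto intro!: prod_nonneg simp: vdm_def\<close>)
  also have "(\<Prod>i<d. K ^ d * (fact n / fact (\<nu> i))) = K ^ (d * d) * (\<Prod>i<d. fact n / fact (\<nu> i))"
    by (simp only: prod.distrib prod_constant card_lessThan power_mult)
  also have "?p0 * K ^ (d * d) * (K ^ (d * d) * (\<Prod>i<d. fact n / fact (\<nu> i))) \<le>
      ?p0 * K ^ (d * d) * (K ^ (d * d) * exp (- (s * (s - 1) / (2 * real n))))"
    using prod_fact_ratio_le_exp[OF assms(2) _ sum_deviation[OF assms(1)] _ assms(4,5)] assms(3) K1
    by (intro mult_left_mono) auto
  also have "\<dots> = ?p0 * (K ^ (2 * (d * d)) * exp (- (s * (s - 1) / (2 * real n))))"
    by (simp only: mult_2[of "d * d"] power_add mult.assoc)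
  finally show ?thesis by (simp only: K_def)
qed

text \<open>The deviations sum to zero, so a row too long by more than \<open>r\<close> is
  compensated by the other \<open>d - 1\<close> rows, one of which must fall short by
  \<open>r / d\<close>.\<close>

lemma exists_short_row:
  fixes r :: real
  assumes "\<nu> \<in> strip d (d * n)" and "i < d" and "\<bar>real (\<nu> i) - real n\<bar> > r" and "r \<ge> 0"
  shows "\<exists>k<d. r / real d \<le> real n - real (\<nu> k)"
proof (rule ccontr)
  assume "\<not> ?thesis"
  then have less: "real n - real (\<nu> k) < r / real d" if "k < d" for k
    using that by (meson not_le)
  have d: "real d \<ge> 1" using assms(2) by simp
  have "(\<Sum>k<d. real n - real (\<nu> k)) = (real n - real (\<nu> i)) + (\<Sum>k\<in>{..<d} - {i}. real n - real (\<nu> k))"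
    using assms(2) by (simp add: sum.remove)
  then have "real (\<nu> i) - real n = (\<Sum>k\<in>{..<d} - {i}. real n - real (\<nu> k))"
    using sum_deviation[OF assms(1)] by simp
  also have "\<dots> \<le> (\<Sum>k\<in>{..<d} - {i}. r / real d)" using less by (intro sum_mono) (auto intro: less_imp_le)
  also have "\<dots> \<le> r"
    using assms(2,4) d by (simp add: of_nat_diff field_simps)
  finally have "real (\<nu> i) - real n \<le> r" .
  moreover have "r / real d \<le> r" using assms(4) d by (simp add: field_simps mult_le_cancel_left1)
  then have "real n - real (\<nu> i) \<le> r" using less[OF assms(2)] by linarith
  ultimately show False using assms(3) by linarith
qed

subsection \<open>Comparison of the two sums\<close>

text \<open>Both bases are replaced by the larger one; this controls the mixed products away from
  the rectangle.\<close>

lemma powr_mult_powr_le: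
  fixes x y \<alpha> \<beta> :: real
  assumes "x > 0" "y > 0" "0 \<le> \<alpha>" "\<alpha> \<le> \<beta>"
  shows "x powr \<alpha> * y powr (\<beta> - \<alpha>) \<le> x powr \<beta> + y powr \<beta>"
proof -
  have "x powr \<alpha> * y powr (\<beta> - \<alpha>) \<le> max x y powr \<alpha> * max x y powr (\<beta> - \<alpha>)"
    using assms by (intro mult_mono powr_mono2) auto
  also have "\<dots> = max x y powr \<beta>" by (simp flip: powr_add)
  also have "\<dots> \<le> x powr \<beta> + y powr \<beta>" by (simp add: max_def)
  finally show ?thesis .
qed

lemma abs_powr_mult_powr_diff_le:
  fixes x y \<alpha> \<beta> \<delta> :: real
  assumes "x > 0" "y > 0" "0 \<le> \<alpha>" "\<alpha> \<le> \<beta>" and "\<bar>ln y - ln x\<bar> \<le> \<delta>"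
  shows "\<bar>x powr \<alpha> * y powr (\<beta> - \<alpha>) - x powr \<beta>\<bar> \<le> (exp (\<beta> * \<delta>) - 1) * x powr \<beta>"
proof -
  define t where "t = (\<beta> - \<alpha>) * (ln y - ln x)"
  have "x powr \<alpha> * y powr (\<beta> - \<alpha>) = exp t * x powr \<beta>"
    using assms by (simp add: powr_def t_def algebra_simps flip: exp_add)
  then have "x powr \<alpha> * y powr (\<beta> - \<alpha>) - x powr \<beta> = (exp t - 1) * x powr \<beta>"
    by (simp add: left_diff_distrib)
  then have "\<bar>x powr \<alpha> * y powr (\<beta> - \<alpha>) - x powr \<beta>\<bar> = \<bar>exp t - 1\<bar> * x powr \<beta>"
    by (simp add: abs_mult)
  moreover have "\<bar>t\<bar> \<le> \<beta> * \<delta>"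
    unfolding t_def abs_mult using assms by (intro mult_mono) auto
  moreover have "\<bar>exp t - 1\<bar> \<le> exp \<bar>t\<bar> - 1"
  proof (cases "t \<ge> 0")
    case False
    \<comment> \<open>For negative \<open>t\<close>, the inequality \<open>cosh t \<ge> 1\<close>
      says that \<open>1 - exp t \<le> exp (- t) - 1\<close>.\<close>
    have "exp t + exp (- t) \<ge> 2" using cosh_real_ge_1[of t] by (simp add: cosh_def)
    with False show ?thesis by simp
  qed simp
  ultimately show ?thesis
    by (smt (verit) exp_le_cancel_iff mult_right_mono powr_ge_zero)
qed

theorem theorem7:
  fixes d :: nat and \<alpha> \<beta> :: real
  assumes "d \<ge> 2" and "\<beta> > 0" and "0 \<le> \<alpha>" and "\<alpha> \<le> \<beta>"
  shows "(\<lambda>n. S d (d * n) \<beta>) \<sim>[sequentially]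
         (\<lambda>n. \<Sum>\<mu> | \<mu> \<turnstile> d * n \<and> diagram \<mu> \<subseteq> diagram (rectangle d (2 * n)).
                real (pdim \<mu>) powr \<alpha> * real (pdim (complement_in d (2 * n) \<mu>)) powr (\<beta> - \<alpha>))"
proof -
  define T where "T n = (\<Sum>\<mu>\<in>boxed d (2 * n) (d * n).
      real (pdim \<mu>) powr \<alpha> * real (pdim (complement_in d (2 * n) \<mu>)) powr (\<beta> - \<alpha>))" for n
  \<comment> \<open>The exponent lies between 1/2, above which the tail factor decays, and 2/3,
    below which the cubic error of the expansion vanishes.\<close>
  define r where "r n = real n powr (3/5)" for n
  \<comment> \<open>The relative error on the window \<open>W\<close>: the logarithmic bound of
    \<open>abs_ln_pdim_complement_le\<close> passed through
    \<open>abs_powr_mult_powr_diff_le\<close>.\<close>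
  define \<epsilon> where "\<epsilon> n = exp (\<beta> * (2 * real d * ((r n + real d) *
      (2 * (r n + real d)\<^sup>2 / (real n)\<^sup>2 + 1 / (2 * real n))))) - 1" for n
  \<comment> \<open>The bound of \<open>pdim_tail_le\<close> with \<open>s = r n / d\<close>;
    multiplying its power by the number of partitions gives \<open>\<eta> n\<close>.\<close>
  define \<tau> where "\<tau> n = real (d * n + d) ^ (2 * (d * d)) *
      exp (- (r n / real d * (r n / real d - 1) / (2 * real n)))" for n
  define \<eta> where "\<eta> n = real ((d * n + 1) ^ d) * \<tau> n powr \<beta>" for n
  have d0: "d > 0" "real d > 0" using assms(1) by auto
  have "\<epsilon> \<longlonglongrightarrow> 0"
    unfolding \<epsilon>_def r_def by (rule tendsto_window_error) (use d0 in auto)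
  have "\<eta> \<longlonglongrightarrow> 0"
  proof -
    have "\<eta> = (\<lambda>n. (real d * real n + 1) powr real d * ((real d * real n + real d) powr real (2 * (d * d)) *
        exp (- (real n powr (3/5) / real d * (real n powr (3/5) / real d - 1) / (2 * real n)))) powr \<beta>)"
    proof
      fix n
      have "real d * real n + 1 > 0" "real d * real n + real d > 0"
        using d0 by (auto intro: add_nonneg_pos)
      then show "\<eta> n = (real d * real n + 1) powr real d * ((real d * real n + real d) powr real (2 * (d * d)) *
        exp (- (real n powr (3/5) / real d * (real n powr (3/5) / real d - 1) / (2 * real n)))) powr \<beta>"
        by (subst (1 2) powr_realpow) (simp_all add: \<eta>_def \<tau>_def r_def add.commute)
    qed
    also have "\<dots> \<longlonglongrightarrow> 0" by (rule tendsto_polynomial_times_exp_neg) (use d0 assms(2) in auto)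
    finally show ?thesis .
  qed

  \<comment> \<open>The tail counts three times: once in \<open>S\<close>, and up to twice in
    \<open>T\<close>, where a mixed product is bounded by two pure powers.\<close>
  have bound: "\<bar>T n - S d (d * n) \<beta>\<bar> \<le> (\<epsilon> n + 3 * \<eta> n) * S d (d * n) \<beta>"
    if n: "n > 0" and rd: "r n + real d \<le> real n / 2" and r1: "r n / real d \<ge> 1" for n
  proof -
    define P Q W where "P = strip d (d * n)" and "Q = boxed d (2 * n) (d * n)"
      and "W = {\<nu> \<in> P. \<forall>i<d. \<bar>real (\<nu> i) - real n\<bar> \<le> r n}"
    define c where "c = complement_in d (2 * n)"
    define p where "p \<nu> = real (pdim \<nu>)" for \<nu>
    define p0 where "p0 = p (rectangle d n)"
    have finP: "finite P" unfolding P_def by (rule finite_strip)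
    have QP: "Q \<subseteq> P" by (auto simp: Q_def P_def boxed_def)
    have WQ: "W \<subseteq> Q"
    proof
      fix \<nu> assume \<nu>: "\<nu> \<in> W"
      have "\<nu> i \<le> 2 * n" for i
      proof (cases "i < d")
        case True
        then have "\<bar>real (\<nu> i) - real n\<bar> \<le> real n" using \<nu> rd by (force simp: W_def)
        then show ?thesis by linarith
      next
        case False
        then show ?thesis using \<nu> by (auto simp: W_def P_def strip_def at_most_rows_def)
      qed
      then show "\<nu> \<in> Q" using \<nu> by (auto simp: W_def P_def Q_def boxed_def)
    qed
    have pos: "p \<nu> > 0" if "\<nu> \<in> P" for \<nu>
      using that pdim_pos by (auto simp: P_def p_def strip_def)
    have cQ: "c \<mu> \<in> Q" "c (c \<mu>) = \<mu>" if "\<mu> \<in> Q" for \<mu>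
      using complement_in_boxed that by (auto simp: Q_def c_def)
    \<comment> \<open>The window is symmetric about \<open>n\<close>, so complementation also
      permutes \<open>Q - W\<close>, and the two pure sums over it agree.\<close>
    have cW: "c \<mu> \<in> W \<longleftrightarrow> \<mu> \<in> W" if "\<mu> \<in> Q" for \<mu>
    proof -
      have *: "c \<nu> \<in> W" if \<nu>: "\<nu> \<in> W" for \<nu>
      proof -
        have "\<bar>real (c \<nu> i) - real n\<bar> \<le> r n" if "i < d" for i
        proof -
          have "\<nu> (d - 1 - i) \<le> 2 * n" using \<nu> WQ by (auto simp: Q_def boxed_def)
          then have "real (c \<nu> i) - real n = real n - real (\<nu> (d - 1 - i))"
            using that by (simp add: c_def complement_in_def of_nat_diff)
          moreover have "\<bar>real (\<nu> (d - 1 - i)) - real n\<bar> \<le> r n" using \<nu> that by (auto simp: W_def)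
          ultimately show ?thesis by (simp add: abs_minus_commute)
        qed
        then show ?thesis using cQ(1)[of \<nu>] \<nu> WQ QP by (auto simp: W_def)
      qed
      show ?thesis using *[of \<mu>] *[of "c \<mu>"] cQ(2)[OF that] by auto
    qed
    define tail where "tail = (\<Sum>\<nu>\<in>P - W. p \<nu> powr \<beta>)"
    have S: "S d (d * n) \<beta> = (\<Sum>\<nu>\<in>P. p \<nu> powr \<beta>)"
      unfolding S_def strip_eq P_def p_def ..
    have S_split: "S d (d * n) \<beta> = (\<Sum>\<nu>\<in>W. p \<nu> powr \<beta>) + tail"
      unfolding S tail_def using sum.subset_diff[of W P "\<lambda>\<nu>. p \<nu> powr \<beta>"] finP WQ QP
      by (simp add: add.commute)
    have T_split: "T n = (\<Sum>\<mu>\<in>W. p \<mu> powr \<alpha> * p (c \<mu>) powr (\<beta> - \<alpha>)) +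
        (\<Sum>\<mu>\<in>Q - W. p \<mu> powr \<alpha> * p (c \<mu>) powr (\<beta> - \<alpha>))"
      unfolding T_def using sum.subset_diff[of W Q "\<lambda>\<mu>. p \<mu> powr \<alpha> * p (c \<mu>) powr (\<beta> - \<alpha>)"]
        finite_subset[OF QP finP] WQ
      by (simp add: Q_def p_def c_def add.commute)

    \<comment> \<open>The rectangle is itself a summand of \<open>S\<close>, which turns bounds
      relative to \<open>p0\<close> into bounds relative to \<open>S\<close>.\<close>
    have p0_le: "p0 powr \<beta> \<le> S d (d * n) \<beta>"
      unfolding S p0_def using finP rectangle_in_strip
      by (intro member_le_sum) (auto simp: P_def)
    have "p \<nu> powr \<beta> \<le> p0 powr \<beta> * \<tau> n powr \<beta>" if \<nu>: "\<nu> \<in> P - W" for \<nu>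
    proof -
      obtain i where "i < d" "\<bar>real (\<nu> i) - real n\<bar> > r n" using \<nu> by (auto simp: W_def not_le)
      then obtain k where "k < d" "r n / real d \<le> real n - real (\<nu> k)"
        using exists_short_row[of \<nu> d n i "r n"] \<nu> by (auto simp: P_def r_def)
      then have "p \<nu> \<le> p0 * \<tau> n"
        using pdim_tail_le[of \<nu> d n k "r n / real d"] \<nu> n r1 by (auto simp: P_def p_def p0_def \<tau>_def)
      then have "p \<nu> powr \<beta> \<le> (p0 * \<tau> n) powr \<beta>"
        using assms(2) by (intro powr_mono2) (auto simp: p_def)
      then show ?thesis by (simp add: powr_mult p0_def p_def \<tau>_def)
    qed
    then have "tail \<le> real (card (P - W)) * (p0 powr \<beta> * \<tau> n powr \<beta>)"
      unfolding tail_def by (rule sum_bounded_above)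
    also have "\<dots> \<le> real ((d * n + 1) ^ d) * (S d (d * n) \<beta> * \<tau> n powr \<beta>)"
    proof (intro mult_mono p0_le of_nat_mono)
      have "card (P - W) \<le> card P" using finP by (intro card_mono) auto
      then show "card (P - W) \<le> (d * n + 1) ^ d" using card_strip_le[of d "d * n"] by (simp add: P_def)
    qed (use p0_le in \<open>auto intro: order_trans[OF _ p0_le]\<close>)
    finally have tail_le: "tail \<le> \<eta> n * S d (d * n) \<beta>" by (simp add: \<eta>_def algebra_simps)

    have "\<bar>p \<mu> powr \<alpha> * p (c \<mu>) powr (\<beta> - \<alpha>) - p \<mu> powr \<beta>\<bar> \<le> \<epsilon> n * p \<mu> powr \<beta>" if \<mu>: "\<mu> \<in> W" for \<mu>
    proof -
      have \<mu>Q: "\<mu> \<in> Q" using \<mu> WQ by auto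
      have "\<bar>ln (p (c \<mu>)) - ln (p \<mu>)\<bar> \<le>
          2 * real d * ((r n + real d) * (2 * (r n + real d)\<^sup>2 / (real n)\<^sup>2 + 1 / (2 * real n)))"
        using abs_ln_pdim_complement_le[of \<mu> d n "r n"] \<mu> \<mu>Q n rd by (auto simp: p_def c_def Q_def W_def)
      then show ?thesis
        unfolding \<epsilon>_def using pos cQ(1)[OF \<mu>Q] \<mu>Q QP assms
        by (intro abs_powr_mult_powr_diff_le) auto
    qed
    then have "(\<Sum>\<mu>\<in>W. \<bar>p \<mu> powr \<alpha> * p (c \<mu>) powr (\<beta> - \<alpha>) - p \<mu> powr \<beta>\<bar>) \<le> (\<Sum>\<mu>\<in>W. \<epsilon> n * p \<mu> powr \<beta>)"
      by (rule sum_mono)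
    also have "\<dots> \<le> \<epsilon> n * S d (d * n) \<beta>"
      unfolding sum_distrib_left[symmetric] S
    proof (intro mult_left_mono sum_mono2 finP)
      show "0 \<le> \<epsilon> n" using assms(2) by (auto simp: \<epsilon>_def r_def)
    qed (use WQ QP in auto)
    finally have main: "\<bar>(\<Sum>\<mu>\<in>W. p \<mu> powr \<alpha> * p (c \<mu>) powr (\<beta> - \<alpha>)) - (\<Sum>\<mu>\<in>W. p \<mu> powr \<beta>)\<bar> \<le>
        \<epsilon> n * S d (d * n) \<beta>"
      unfolding sum_subtractf[symmetric] by (rule order_trans[OF sum_abs])

    have "(\<Sum>\<mu>\<in>Q - W. p \<mu> powr \<alpha> * p (c \<mu>) powr (\<beta> - \<alpha>)) \<le> (\<Sum>\<mu>\<in>Q - W. p \<mu> powr \<beta> + p (c \<mu>) powr \<beta>)"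
      using pos cQ(1) QP assms by (intro sum_mono powr_mult_powr_le) auto
    also have "\<dots> = (\<Sum>\<mu>\<in>Q - W. p \<mu> powr \<beta>) + (\<Sum>\<mu>\<in>Q - W. p (c \<mu>) powr \<beta>)" by (rule sum.distrib)
    finally have "(\<Sum>\<mu>\<in>Q - W. p \<mu> powr \<alpha> * p (c \<mu>) powr (\<beta> - \<alpha>)) \<le>
        (\<Sum>\<mu>\<in>Q - W. p \<mu> powr \<beta>) + (\<Sum>\<mu>\<in>Q - W. p (c \<mu>) powr \<beta>)" .
    moreover have "(\<Sum>\<mu>\<in>Q - W. p (c \<mu>) powr \<beta>) = (\<Sum>\<mu>\<in>Q - W. p \<mu> powr \<beta>)"
      by (rule sum.reindex_bij_witness[of _ c c]) (auto simp: cQ cW)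
    moreover have "(\<Sum>\<mu>\<in>Q - W. p \<mu> powr \<beta>) \<le> tail"
      unfolding tail_def using finP QP by (intro sum_mono2) auto
    moreover have "(\<Sum>\<mu>\<in>Q - W. p \<mu> powr \<alpha> * p (c \<mu>) powr (\<beta> - \<alpha>)) \<ge> 0" by (intro sum_nonneg) auto
    moreover have "tail \<ge> 0" unfolding tail_def by (intro sum_nonneg) auto
    ultimately have "\<bar>T n - S d (d * n) \<beta>\<bar> \<le> \<epsilon> n * S d (d * n) \<beta> + 3 * tail"
      using main unfolding T_split S_split by linarith
    then show ?thesis using tail_le by (simp add: algebra_simps)
  qed

  have S_pos: "S d (d * n) \<beta> > 0" for n
    unfolding S_def strip_eq
    using finite_strip rectangle_in_strip[of d n] pdim_pos
    by (intro sum_pos2[of _ "rectangle d n"]) (auto simp: strip_def)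
  have ev: "\<forall>\<^sub>F n in sequentially. norm (T n / S d (d * n) \<beta> - 1) \<le> \<epsilon> n + 3 * \<eta> n"
  proof -
    \<comment> \<open>\<open>r n\<close> grows without bound but more slowly than \<open>n\<close>,
      so the side conditions of \<open>bound\<close> hold eventually.\<close>
    have "\<forall>\<^sub>F n in sequentially. r n + real d \<le> real n / 2"
      unfolding r_def using d0 by real_asymp
    moreover have "\<forall>\<^sub>F n in sequentially. r n / real d \<ge> 1"
      unfolding r_def using d0 by real_asymp
    ultimately show ?thesis using eventually_gt_at_top[of 0]
    proof eventually_elim
      case (elim n)
      have "norm (T n / S d (d * n) \<beta> - 1) = \<bar>T n - S d (d * n) \<beta>\<bar> / S d (d * n) \<beta>"
        using S_pos[of n] by (simp add: field_simps abs_div_pos[symmetric])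
      then show ?case using bound[OF elim(3,1,2)] S_pos[of n] by (simp add: divide_le_eq)
    qed
  qed
  have "(\<lambda>n. \<epsilon> n + 3 * \<eta> n) \<longlonglongrightarrow> 0 + 3 * 0"
    by (intro tendsto_intros \<open>\<epsilon> \<longlonglongrightarrow> 0\<close> \<open>\<eta> \<longlonglongrightarrow> 0\<close>)
  then have "(\<lambda>n. T n / S d (d * n) \<beta> - 1) \<longlonglongrightarrow> 0"
    using Lim_null_comparison[OF ev] by simp
  then have "(\<lambda>n. T n / S d (d * n) \<beta>) \<longlonglongrightarrow> 1" by (simp add: LIM_zero_iff)
  then have "T \<sim>[sequentially] (\<lambda>n. S d (d * n) \<beta>)"
    by (rule asymp_equivI')
  then show ?thesis
    unfolding boxed_eq T_def[symmetric] by (simp add: asymp_equiv_sym)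
qed

end
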